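(* Let $C$ be a coalgebra over a field and let $M$ be a left $C$-comodule. The following are equivalent: (i) every $C^*$-submodule of $M^*$ is closed in the finite topology of $M^*$; (ii) $M^*$ is a Noetherian (left) $C^*$-module; (iii) $M$ is an Artinian comodule.
   Context: $C^*$ is the dual algebra with convolution product $(c^*d^* )(c)=c^*(c_1)d^*(c_2)$. A left $C$-comodule $M$ with coaction $m\mapsto m_{-1}\otimes m_0$ is a right $C^*$-module by $m\cdot c^*=c^*(m_{-1})m_0$, so $M^*=\mathrm{Hom}_{\mathbb{K}}(M,\mathbb{K})$ is a left $C^*$-module by $(c^*f)(m)=f(m\cdot c^* )$. The finite topology on $M^*$ has as basis of neighborhoods of $0$ the subspaces $X^\perp=\{f\in M^*\mid f|_X=0\}$ for $X$ ranging over the finite dimensional subcomodules of $M$. A comodule is Artinian if it satisfies the descending chain condition on subcomodules. *)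

theory Defs
  imports
    "HOL-Algebra.Module"
    "HOL-Analysis.Abstract_Topology"
    "HOL-Library.Poly_Mapping"
begin

section \<open>Tensor products of vector spaces\<close>

text \<open>
  A vector space is a type \<open>'v::ab_group_add\<close> with a scalar multiplication satisfying
  the library locale \<open>vector_space\<close>.  The tensor product \<open>V \<otimes> W\<close> is the quotient of the free
  vector space \<open>'v \<times> 'w \<Rightarrow>\<^sub>0 'k\<close> by the subspace spanned by the bilinearity relations;
  its elements are cosets, and the formal sum \<open>\<Sum>\<^sub>i a\<^sub>i (v\<^sub>i, w\<^sub>i)\<close> represents \<open>\<Sum>\<^sub>i a\<^sub>i v\<^sub>i \<otimes> w\<^sub>i\<close>.
  Threefold tensor products are formed in the same way from triples.
\<close>

definition free_scale :: "'k::field \<Rightarrow> ('x \<Rightarrow>\<^sub>0 'k) \<Rightarrow> ('x \<Rightarrow>\<^sub>0 'k)"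
  where "free_scale a = Poly_Mapping.map ((*) a)"

definition gen :: "'x \<Rightarrow> ('x \<Rightarrow>\<^sub>0 'k::field)"
  where "gen x = Poly_Mapping.single x 1"

definition lin_ext ::
  "('k::field \<Rightarrow> 'v::ab_group_add \<Rightarrow> 'v) \<Rightarrow> ('x \<Rightarrow> 'v) \<Rightarrow> ('x \<Rightarrow>\<^sub>0 'k) \<Rightarrow> 'v"
  where "lin_ext s \<phi> p = (\<Sum>x\<in>Poly_Mapping.keys p. s (Poly_Mapping.lookup p x) (\<phi> x))"

text \<open>Linearity relations in one tensor slot; \<open>i\<close> inserts a vector into that slot, the other
  slots being fixed.\<close>

definition slot_relations ::
  "('k::field \<Rightarrow> 'v::ab_group_add \<Rightarrow> 'v) \<Rightarrow> ('v \<Rightarrow> 'x) \<Rightarrow> ('x \<Rightarrow>\<^sub>0 'k) set"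
  where "slot_relations s i =
    {gen (i (v + w)) - gen (i v) - gen (i w) | v w. True} \<union>
    {gen (i (s a v)) - free_scale a (gen (i v)) | a v. True}"

definition tensor_relations ::
  "('k::field \<Rightarrow> 'v::ab_group_add \<Rightarrow> 'v) \<Rightarrow> ('k \<Rightarrow> 'w::ab_group_add \<Rightarrow> 'w)
    \<Rightarrow> ('v \<times> 'w \<Rightarrow>\<^sub>0 'k) set"
  where "tensor_relations sV sW = module.span free_scale
    ((\<Union>w. slot_relations sV (\<lambda>v. (v, w))) \<union> (\<Union>v. slot_relations sW (\<lambda>w. (v, w))))"

definition tensor3_relations ::
  "('k::field \<Rightarrow> 'u::ab_group_add \<Rightarrow> 'u) \<Rightarrow> ('k \<Rightarrow> 'v::ab_group_add \<Rightarrow> 'v)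
    \<Rightarrow> ('k \<Rightarrow> 'w::ab_group_add \<Rightarrow> 'w) \<Rightarrow> ('u \<times> 'v \<times> 'w \<Rightarrow>\<^sub>0 'k) set"
  where "tensor3_relations sU sV sW = module.span free_scale
    ((\<Union>v w. slot_relations sU (\<lambda>u. (u, v, w))) \<union>
     (\<Union>u w. slot_relations sV (\<lambda>v. (u, v, w))) \<union>
     (\<Union>u v. slot_relations sW (\<lambda>w. (u, v, w))))"

definition coset :: "('x \<Rightarrow>\<^sub>0 'k::field) set \<Rightarrow> ('x \<Rightarrow>\<^sub>0 'k) \<Rightarrow> ('x \<Rightarrow>\<^sub>0 'k) set"
  where "coset R p = {q. q - p \<in> R}"

definition quotient_space :: "('x \<Rightarrow>\<^sub>0 'k::field) set \<Rightarrow> ('x \<Rightarrow>\<^sub>0 'k) set set"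
  where "quotient_space R = {coset R p | p. True}"

text \<open>A representative of a coset, i.e. of a tensor; it is only used where the result does not
  depend on the choice.\<close>

definition rep :: "('x \<Rightarrow>\<^sub>0 'k::field) set \<Rightarrow> ('x \<Rightarrow>\<^sub>0 'k)"
  where "rep X = (SOME p. p \<in> X)"

definition linear_to_quotient ::
  "('k::field \<Rightarrow> 'v::ab_group_add \<Rightarrow> 'v) \<Rightarrow> ('x \<Rightarrow>\<^sub>0 'k) set \<Rightarrow> ('v \<Rightarrow> ('x \<Rightarrow>\<^sub>0 'k) set) \<Rightarrow> bool"
  where "linear_to_quotient s R f \<longleftrightarrow>
    (\<forall>v. f v \<in> quotient_space R) \<and>
    (\<forall>v w. \<forall>p\<in>f v. \<forall>q\<in>f w. p + q \<in> f (v + w)) \<and>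
    (\<forall>a v. \<forall>p\<in>f v. free_scale a p \<in> f (s a v))"

text \<open>For \<open>p\<close> representing a tensor in \<open>V \<otimes> W\<close>: a representative of its image under
  \<open>f \<otimes> id\<close>, respectively \<open>id \<otimes> g\<close>.\<close>

definition tensor_left ::
  "('v \<Rightarrow> ('x \<times> 'y \<Rightarrow>\<^sub>0 'k::field) set) \<Rightarrow> ('v \<times> 'w \<Rightarrow>\<^sub>0 'k) \<Rightarrow> ('x \<times> 'y \<times> 'w \<Rightarrow>\<^sub>0 'k)"
  where "tensor_left f =
    lin_ext free_scale (\<lambda>(v, w). lin_ext free_scale (\<lambda>(x, y). gen (x, y, w)) (rep (f v)))"

definition tensor_right ::
  "('w \<Rightarrow> ('x \<times> 'y \<Rightarrow>\<^sub>0 'k::field) set) \<Rightarrow> ('v \<times> 'w \<Rightarrow>\<^sub>0 'k) \<Rightarrow> ('v \<times> 'x \<times> 'y \<Rightarrow>\<^sub>0 'k)"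
  where "tensor_right g =
    lin_ext free_scale (\<lambda>(v, w). lin_ext free_scale (\<lambda>(x, y). gen (v, x, y)) (rep (g w)))"


section \<open>Coalgebras and left comodules\<close>

text \<open>The counit axioms use the identifications \<open>K \<otimes> V = V = V \<otimes> K\<close>.\<close>

locale coalgebra = vector_space sC
  for sC :: "'k::field \<Rightarrow> 'c::ab_group_add \<Rightarrow> 'c" +
  fixes \<Delta> :: "'c \<Rightarrow> ('c \<times> 'c \<Rightarrow>\<^sub>0 'k) set"
    and \<epsilon> :: "'c \<Rightarrow> 'k"
  assumes comult_linear: "linear_to_quotient sC (tensor_relations sC sC) \<Delta>"
    and counit_linear: "Vector_Spaces.linear sC (*) \<epsilon>"
    and coassoc: "coset (tensor3_relations sC sC sC) (tensor_left \<Delta> (rep (\<Delta> c))) =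
      coset (tensor3_relations sC sC sC) (tensor_right \<Delta> (rep (\<Delta> c)))"
    and counit_left: "lin_ext sC (\<lambda>(x, y). sC (\<epsilon> x) y) (rep (\<Delta> c)) = c"
    and counit_right: "lin_ext sC (\<lambda>(x, y). sC (\<epsilon> y) x) (rep (\<Delta> c)) = c"

locale left_comodule = coalgebra sC \<Delta> \<epsilon> + M: vector_space sM
  for sC :: "'k::field \<Rightarrow> 'c::ab_group_add \<Rightarrow> 'c"
    and \<Delta> :: "'c \<Rightarrow> ('c \<times> 'c \<Rightarrow>\<^sub>0 'k) set"
    and \<epsilon> :: "'c \<Rightarrow> 'k"
    and sM :: "'k \<Rightarrow> 'm::ab_group_add \<Rightarrow> 'm" +
  fixes \<rho> :: "'m \<Rightarrow> ('c \<times> 'm \<Rightarrow>\<^sub>0 'k) set"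
  assumes coact_linear: "linear_to_quotient sM (tensor_relations sC sM) \<rho>"
    and coact_coassoc: "coset (tensor3_relations sC sC sM) (tensor_left \<Delta> (rep (\<rho> m))) =
      coset (tensor3_relations sC sC sM) (tensor_right \<rho> (rep (\<rho> m)))"
    and coact_counit: "lin_ext sM (\<lambda>(x, n). sM (\<epsilon> x) n) (rep (\<rho> m)) = m"

text \<open>The condition \<open>\<rho>(X) \<subseteq> C \<otimes> X\<close> says that \<open>\<rho> x\<close> has a representative with all its
  second components in \<open>X\<close>.\<close>

definition subcomodule ::
  "('k::field \<Rightarrow> 'm::ab_group_add \<Rightarrow> 'm) \<Rightarrow> ('m \<Rightarrow> ('c \<times> 'm \<Rightarrow>\<^sub>0 'k) set) \<Rightarrow> 'm set \<Rightarrow> bool"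
  where "subcomodule sM \<rho> X \<longleftrightarrow>
    module.subspace sM X \<and> (\<forall>x\<in>X. \<exists>p\<in>\<rho> x. Poly_Mapping.keys p \<subseteq> UNIV \<times> X)"

definition finite_dim_subcomodule ::
  "('k::field \<Rightarrow> 'm::ab_group_add \<Rightarrow> 'm) \<Rightarrow> ('m \<Rightarrow> ('c \<times> 'm \<Rightarrow>\<^sub>0 'k) set) \<Rightarrow> 'm set \<Rightarrow> bool"
  where "finite_dim_subcomodule sM \<rho> X \<longleftrightarrow>
    subcomodule sM \<rho> X \<and> (\<exists>B. finite B \<and> X = module.span sM B)"

definition artinian_comodule ::
  "('k::field \<Rightarrow> 'm::ab_group_add \<Rightarrow> 'm) \<Rightarrow> ('m \<Rightarrow> ('c \<times> 'm \<Rightarrow>\<^sub>0 'k) set) \<Rightarrow> bool"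
  where "artinian_comodule sM \<rho> \<longleftrightarrow>
    (\<forall>X :: nat \<Rightarrow> 'm set. (\<forall>n. subcomodule sM \<rho> (X n)) \<and> (\<forall>n. X (Suc n) \<subseteq> X n) \<longrightarrow>
      (\<exists>n. \<forall>k\<ge>n. X k = X n))"


section \<open>The dual algebra and the dual module\<close>

definition dual_space :: "('k::field \<Rightarrow> 'v::ab_group_add \<Rightarrow> 'v) \<Rightarrow> ('v \<Rightarrow> 'k) set"
  where "dual_space s = {f. Vector_Spaces.linear s (*) f}"

definition convolution ::
  "('c \<Rightarrow> ('c \<times> 'c \<Rightarrow>\<^sub>0 'k::field) set) \<Rightarrow> ('c \<Rightarrow> 'k) \<Rightarrow> ('c \<Rightarrow> 'k) \<Rightarrow> 'c \<Rightarrow> 'k"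
  where "convolution \<Delta> f g c = lin_ext (*) (\<lambda>(x, y). f x * g y) (rep (\<Delta> c))"

definition dual_algebra ::
  "('k::field \<Rightarrow> 'c::ab_group_add \<Rightarrow> 'c) \<Rightarrow> ('c \<Rightarrow> ('c \<times> 'c \<Rightarrow>\<^sub>0 'k) set) \<Rightarrow> ('c \<Rightarrow> 'k)
    \<Rightarrow> ('c \<Rightarrow> 'k) ring"
  where "dual_algebra sC \<Delta> \<epsilon> =
    \<lparr>carrier = dual_space sC, mult = convolution \<Delta>, one = \<epsilon>,
     zero = (\<lambda>c. 0), add = (\<lambda>f g c. f c + g c)\<rparr>"

definition right_action ::
  "('k::field \<Rightarrow> 'm::ab_group_add \<Rightarrow> 'm) \<Rightarrow> ('m \<Rightarrow> ('c \<times> 'm \<Rightarrow>\<^sub>0 'k) set) \<Rightarrow> 'm \<Rightarrow> ('c \<Rightarrow> 'k) \<Rightarrow> 'm"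
  where "right_action sM \<rho> m \<phi> = lin_ext sM (\<lambda>(x, n). sM (\<phi> x) n) (rep (\<rho> m))"

text \<open>The record type of modules in \<open>HOL-Algebra\<close> extends that of rings; the fields
  \<open>mult\<close> and \<open>one\<close> have no meaning for a module.\<close>

definition dual_module ::
  "('k::field \<Rightarrow> 'm::ab_group_add \<Rightarrow> 'm) \<Rightarrow> ('m \<Rightarrow> ('c \<times> 'm \<Rightarrow>\<^sub>0 'k) set)
    \<Rightarrow> ('c \<Rightarrow> 'k, 'm \<Rightarrow> 'k) module"
  where "dual_module sM \<rho> =
    \<lparr>carrier = dual_space sM, mult = undefined, one = undefined,
     zero = (\<lambda>m. 0), add = (\<lambda>f g m. f m + g m),
     smult = (\<lambda>\<phi> f m. f (right_action sM \<rho> m \<phi>))\<rparr>"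

text \<open>The library predicate \<open>submodule\<close> does not require the ring to be commutative (unlike
  the library locale for modules).\<close>

definition noetherian_module ::
  "('a, 'x) ring_scheme \<Rightarrow> ('a, 'b, 'y) module_scheme \<Rightarrow> bool"
  where "noetherian_module R M \<longleftrightarrow>
    (\<forall>N :: nat \<Rightarrow> 'b set. (\<forall>n. submodule (N n) R M) \<and> (\<forall>n. N n \<subseteq> N (Suc n)) \<longrightarrow>
      (\<exists>n. \<forall>k\<ge>n. N k = N n))"


section \<open>The finite topology\<close>

definition perp :: "('k::field \<Rightarrow> 'm::ab_group_add \<Rightarrow> 'm) \<Rightarrow> 'm set \<Rightarrow> ('m \<Rightarrow> 'k) set"
  where "perp sM X = {f \<in> dual_space sM. \<forall>x\<in>X. f x = 0}"

definition finite_topology_open ::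
  "('k::field \<Rightarrow> 'm::ab_group_add \<Rightarrow> 'm) \<Rightarrow> ('m \<Rightarrow> ('c \<times> 'm \<Rightarrow>\<^sub>0 'k) set)
    \<Rightarrow> ('m \<Rightarrow> 'k) set \<Rightarrow> bool"
  where "finite_topology_open sM \<rho> U \<longleftrightarrow> U \<subseteq> dual_space sM \<and>
    (\<forall>f\<in>U. \<exists>X. finite_dim_subcomodule sM \<rho> X \<and> {\<lambda>m. f m + g m | g. g \<in> perp sM X} \<subseteq> U)"

definition finite_topology ::
  "('k::field \<Rightarrow> 'm::ab_group_add \<Rightarrow> 'm) \<Rightarrow> ('m \<Rightarrow> ('c \<times> 'm \<Rightarrow>\<^sub>0 'k) set) \<Rightarrow> ('m \<Rightarrow> 'k) topology"
  where "finite_topology sM \<rho> = topology (finite_topology_open sM \<rho>)"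

end

theory Submission
  imports Defs
begin

text \<open>
  A cyclic submodule \<open>C\<^sup>* f\<close> of \<open>M\<^sup>*\<close> is the annihilator of a subcomodule, namely of the kernel of
  \<open>m \<mapsto> m\<^sub>-\<^sub>1 f(m\<^sub>0)\<close>, and \<open>X\<^sup>\<bottom> + Y\<^sup>\<bottom> = (X \<inter> Y)\<^sup>\<bottom>\<close> for all subspaces; so finitely generated
  submodules are annihilators of subcomodules.  The descending chain condition extends this to
  all submodules, which gives both (i) and (ii), because \<open>X \<mapsto> X\<^sup>\<bottom>\<close> is injective and its values
  are closed.  Injectivity also gives (ii) \<open>\<Longrightarrow>\<close> (iii).  If a chain \<open>X\<^sub>n\<close> of subcomodules does not
  become stationary, then some functional that vanishes on \<open>\<Inter>\<^sub>n X\<^sub>n\<close> vanishes on no \<open>X\<^sub>n\<close>; it lies in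
  the closure of the submodule \<open>\<Union>\<^sub>n X\<^sub>n\<^sup>\<bottom>\<close> but not in the submodule, so (i) fails.
\<close>

section \<open>Linear functionals\<close>

lemma vector_space_self: "vector_space ((*) :: 'k::field \<Rightarrow> 'k \<Rightarrow> 'k)"
  by unfold_locales (auto simp: algebra_simps)

context vector_space
begin

lemma dual_space_iff:
  "f \<in> dual_space scale \<longleftrightarrow>
    (\<forall>x y. f (x + y) = f x + f y) \<and> (\<forall>a x. f (scale a x) = a * f x)"
  using vector_space_axioms vector_space_self unfolding dual_space_def Vector_Spaces.linear_iff by blast

lemma
  assumes "f \<in> dual_space scale"
  shows dual_space_add: "f (x + y) = f x + f y"
    and dual_space_scale: "f (scale a x) = a * f x"
    and dual_space_0: "f 0 = 0"
    and dual_space_diff: "f (x - y) = f x - f y"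
proof -
  show add: "f (x + y) = f x + f y" for x y using assms by (simp add: dual_space_iff)
  show scale: "f (scale a x) = a * f x" for a x using assms by (simp add: dual_space_iff)
  show "f 0 = 0" using scale[of 0 0] by simp
  show "f (x - y) = f x - f y" using add[of "x - y" y] by simp
qed

lemma dual_space_extend:
  assumes "independent B"
  obtains f where "f \<in> dual_space scale" "\<And>b. b \<in> B \<Longrightarrow> f b = g b"
proof -
  interpret vector_space_pair scale "(*) :: 'a \<Rightarrow> 'a \<Rightarrow> 'a"
    by (intro vector_space_pair.intro vector_space_axioms vector_space_self)
  show thesis
    using linear_independent_extend[OF assms, of g] that by (auto simp: dual_space_def)
qed

lemma basis_of_subspace:
  assumes "subspace X"
  obtains B where "independent B" "span B = X"
  by (metis assms basis_exists span_subspace)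

text \<open>A basis of \<open>X\<close> stays independent when \<open>x\<close> is added, so a
  functional may be prescribed as 0 on the basis and 1 at \<open>x\<close>.\<close>

lemma dual_space_separate:
  assumes "subspace X" "x \<notin> X"
  obtains f where "f \<in> perp scale X" "f x = 1"
proof -
  obtain B where B: "independent B" "span B = X"
    using basis_of_subspace assms(1) .
  with assms(2) have "independent (insert x B)"
    by (simp add: independent_insertI)
  then obtain f where f: "f \<in> dual_space scale" "\<And>b. b \<in> insert x B \<Longrightarrow> f b = (if b = x then 1 else 0)"
    by (rule dual_space_extend[where g = "\<lambda>b. if b = x then 1 else 0"]) blast
  interpret vector_space_pair scale "(*) :: 'a \<Rightarrow> 'a \<Rightarrow> 'a"
    by (intro vector_space_pair.intro vector_space_axioms vector_space_self)
  have "f y = 0" if "y \<in> X" for y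
  proof (rule linear_eq_0_on_span)
    show "Vector_Spaces.linear scale (*) f" using f(1) by (simp add: dual_space_def)
    show "y \<in> span B" using B that by simp
    show "f b = 0" if "b \<in> B" for b
      using f(2)[of b] that B assms(2) span_base[of b B] by auto
  qed
  with f show thesis by (intro that[of f]) (auto simp: perp_def)
qed

text \<open>Separation by functionals makes the passage to annihilators injective on subspaces; this
  transports chain conditions between \<open>M\<close> and its dual.\<close>

lemma subspace_eq_annihilator_perp:
  assumes "subspace X"
  shows "X = {x. \<forall>f\<in>perp scale X. f x = 0}"
proof -
  have "x \<in> X" if "\<forall>f\<in>perp scale X. f x = 0" for x
    by (rule ccontr, rule dual_space_separate[OF assms]) (use that in auto)
  moreover have "\<forall>f\<in>perp scale X. f x = 0" if "x \<in> X" for x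
    using that by (simp add: perp_def)
  ultimately show ?thesis by blast
qed

lemma subspace_annihilator: "F \<subseteq> dual_space scale \<Longrightarrow> subspace {x. \<forall>f\<in>F. f x = 0}"
  by (rule subspaceI) (auto simp: dual_space_0 subset_iff dual_space_add dual_space_scale)

text \<open>Let \<open>q\<close> be linear with kernel \<open>A\<close>, and let \<open>r\<close>
  choose preimages under \<open>q\<close> linearly in \<open>B\<close>. Then \<open>f\<close> after
  \<open>r\<close> after \<open>q\<close> vanishes on \<open>A\<close>, and it agrees with
  \<open>f\<close> on \<open>B\<close> because \<open>r (q b) - b\<close> lies in both
  \<open>A\<close> and \<open>B\<close>.\<close>

lemma perp_Int_decompose:
  assumes A: "subspace A" and B: "subspace B" and f: "f \<in> perp scale (A \<inter> B)"
  obtains g h where "g \<in> perp scale A" "h \<in> perp scale B" "f = (\<lambda>x. g x + h x)"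
proof -
  interpret pair: vector_space_pair scale scale
    by (intro vector_space_pair.intro vector_space_axioms)
  \<comment> \<open>\<open>p\<close> is a linear projection onto \<open>A\<close>, so the kernel of
    \<open>q\<close> is exactly \<open>A\<close>.\<close>
  obtain p where p: "range p \<subseteq> A" "Vector_Spaces.linear scale scale p" "\<And>a. a \<in> A \<Longrightarrow> p a = a"
    using pair.linear_exists_left_inverse_on[OF linear_id A] by auto
  define q where "q x = x - p x" for x
  have ql: "Vector_Spaces.linear scale scale q"
    unfolding q_def using p(2) by (simp add: Vector_Spaces.linear_iff scale_right_diff_distrib algebra_simps)
  obtain r where r: "range r \<subseteq> B" "Vector_Spaces.linear scale scale r" "\<And>x. x \<in> q ` B \<Longrightarrow> q (r x) = x"
    using pair.linear_exists_right_inverse_on[OF ql B] by auto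
  define g where "g x = f (r (q x))" for x
  have fl: "f \<in> dual_space scale" using f by (simp add: perp_def)
  have gl: "g \<in> dual_space scale"
    using ql r(2) fl by (simp add: Vector_Spaces.linear_iff dual_space_iff g_def)
  note f_diff = dual_space_diff[OF fl]
  have "g a = 0" if "a \<in> A" for a
    using that p(3) pair.linear_0[OF r(2)] f_diff[of 0 0] by (simp add: g_def q_def)
  with gl have 1: "g \<in> perp scale A" by (simp add: perp_def)
  have "g b = f b" if "b \<in> B" for b
  proof -
    have "q (r (q b) - b) = 0"
      using r(3)[of "q b"] that pair.linear_diff[OF ql] by simp
    then have "r (q b) - b \<in> A" using p(1) unfolding q_def by (metis eq_iff_diff_eq_0 range_subsetD)
    moreover have "r (q b) - b \<in> B" using r(1) that B by (auto intro: subspace_diff)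
    ultimately have "f (r (q b) - b) = 0" using f by (simp add: perp_def)
    then show ?thesis by (simp add: f_diff g_def)
  qed
  with gl fl have 2: "(\<lambda>x. f x - g x) \<in> perp scale B"
    by (simp add: perp_def dual_space_iff algebra_simps)
  show thesis by (rule that[OF 1 2]) simp
qed

text \<open>Choose \<open>n\<close> with \<open>dim (V n)\<close> least. A vector of
  \<open>V n\<close> outside a later \<open>V k\<close> would enlarge a basis of \<open>V k\<close>
  to an independent subset of \<open>V n\<close>, so \<open>V k\<close> would have smaller dimension
  still.\<close>

lemma finite_dim_chain_stable:
  fixes V :: "nat \<Rightarrow> 'b set"
  assumes "finite W" and sub: "\<And>n. subspace (V n)" and le: "\<And>n. V n \<subseteq> span W"
    and dec: "antimono V"
  obtains n where "\<And>k. n \<le> k \<Longrightarrow> V k = V n"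
proof -
  obtain n where n: "\<And>k. dim (V n) \<le> dim (V k)"
    using ex_has_least_nat[of "\<lambda>_. True" 0 "\<lambda>k. dim (V k)"] by auto
  have n_le: "V n \<subseteq> V k" if "n \<le> k" for k
  proof
    fix x assume x: "x \<in> V n"
    obtain B where B: "B \<subseteq> V k" "independent B" "V k \<subseteq> span B" "card B = dim (V k)"
      by (rule basis_exists)
    obtain D where D: "D \<subseteq> V n" "independent D" "V n \<subseteq> span D" "card D = dim (V n)"
      by (rule basis_exists)
    \<comment> \<open>The finite set \<open>W\<close> bounds both bases, so that \<open>card\<close>
      really measures dimension; it is 0 on infinite sets.\<close>
    have fin: "finite B" "finite D"
      using independent_span_bound[OF assms(1) B(2) subset_trans[OF B(1) le]]
        independent_span_bound[OF assms(1) D(2) subset_trans[OF D(1) le]] by blast+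
    show "x \<in> V k"
    proof (rule ccontr)
      assume "x \<notin> V k"
      then have nx: "x \<notin> span B" using span_minimal[OF B(1) sub] by blast
      then have "independent (insert x B)" using B(2) by (simp add: independent_insertI)
      moreover have "insert x B \<subseteq> span D"
        using x B(1) D(3) antimonoD[OF dec that] by blast
      ultimately have "card (insert x B) \<le> card D"
        using independent_span_bound[OF fin(2)] by simp
      moreover have "x \<notin> B" using nx span_base by blast
      ultimately show False using fin n[of k] B(4) D(4) by simp
    qed
  qed
  show thesis
    by (rule that[of n], rule antisym[OF antimonoD[OF dec] n_le])
qed

text \<open>Vectors \<open>x\<^sub>k \<in> X\<^sub>k - X\<^sub>k\<^sub>+\<^sub>1\<close>, one for each proper inclusion, are linearly independent
  modulo \<open>\<Inter>\<^sub>k X\<^sub>k\<close>; the functional takes the value 1 on all of them.\<close>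

lemma functional_detecting_chain:
  fixes X :: "nat \<Rightarrow> 'b set"
  assumes sub: "\<And>n. subspace (X n)" and dec: "antimono X"
    and unstable: "\<nexists>n. \<forall>k\<ge>n. X k = X n"
  obtains f where "f \<in> perp scale (\<Inter>n. X n)" "\<And>n. f \<notin> perp scale (X n)"
proof -
  \<comment> \<open>Indices of the proper inclusions. The chain may pause, but since it never
    becomes stationary there are arbitrarily large ones.\<close>
  define S where "S = {n. X (Suc n) \<noteq> X n}"
  have "\<exists>x. x \<in> X n \<and> x \<notin> X (Suc n)" if "n \<in> S" for n
    using that dec unfolding S_def by (auto dest: antimonoD[of X n "Suc n"])
  then obtain x where x: "\<And>n. n \<in> S \<Longrightarrow> x n \<in> X n" "\<And>n. n \<in> S \<Longrightarrow> x n \<notin> X (Suc n)"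
    by metis
  have S_unbounded: "\<exists>k\<ge>n. k \<in> S" for n
  proof (rule ccontr)
    assume *: "\<not> ?thesis"
    have "X k = X n" if "n \<le> k" for k
      using that by (induction k rule: dec_induct) (use * in \<open>auto simp: S_def\<close>)
    with unstable show False by blast
  qed
  have "subspace (\<Inter>n. X n)"
    by (intro subspace_Int sub)
  then obtain B where B: "independent B" "span B = (\<Inter>n. X n)"
    using basis_of_subspace by blast
  \<comment> \<open>The upper bound \<open>N\<close> permits an induction on \<open>j\<close>
    downwards from \<open>N\<close>.\<close>
  define T where "T N j = B \<union> x ` {k\<in>S. j \<le> k \<and> k < N}" for N j
  have T_sub: "T N j \<subseteq> X j" for N j
  proof -
    have "B \<subseteq> X j" using B(2) span_superset by fast
    moreover have "x k \<in> X j" if "k \<in> S" "j \<le> k" for k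
      using x(1) that dec antimonoD by blast
    ultimately show ?thesis by (auto simp: T_def)
  qed
  have T_indep: "independent (T N j)" if "j \<le> N" for N j
    using that
  proof (induction j rule: inc_induct)
    case base
    have "{k\<in>S. N \<le> k \<and> k < N} = {}" by auto
    then show ?case using B(1) by (simp add: T_def del: Collect_empty_eq)
  next
    case (step j)
    have split: "{k\<in>S. j \<le> k \<and> k < N} =
        (if j \<in> S then insert j {k\<in>S. Suc j \<le> k \<and> k < N} else {k\<in>S. Suc j \<le> k \<and> k < N})"
      using step.hyps by (auto simp: Suc_le_eq le_less)
    show ?case
    proof (cases "j \<in> S")
      case True
      \<comment> \<open>\<open>T N (Suc j)\<close> lies in the subspace \<open>X (Suc j)\<close>,
        which misses \<open>x j\<close>.\<close>
      have "x j \<notin> span (T N (Suc j))"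
        using x(2)[OF True] span_minimal[OF T_sub sub] by blast
      then have "independent (insert (x j) (T N (Suc j)))"
        using step.IH by (rule independent_insertI)
      then show ?thesis using True by (simp add: T_def split)
    next
      case False
      then show ?thesis using step.IH by (simp add: T_def split)
    qed
  qed
  \<comment> \<open>The sets \<open>T N 0\<close> grow with \<open>N\<close>, so independence passes
    to their union.\<close>
  have "independent (\<Union>N. T N 0)"
  proof (rule independent_Union_directed)
    fix C D assume "C \<in> range (\<lambda>N. T N 0)" "D \<in> range (\<lambda>N. T N 0)"
    then obtain N N' where "C = T N 0" "D = T N' 0" by auto
    then show "C \<subseteq> D \<or> D \<subseteq> C"
      unfolding T_def by (cases "N \<le> N'") fastforce+
  qed (use T_indep in auto)
  then obtain f where f: "f \<in> dual_space scale"
      "\<And>b. b \<in> (\<Union>N. T N 0) \<Longrightarrow> f b = (if b \<in> B then 0 else 1)"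
    by (rule dual_space_extend[where g = "\<lambda>b. if b \<in> B then 0 else 1"]) blast
  interpret vector_space_pair scale "(*) :: 'a \<Rightarrow> 'a \<Rightarrow> 'a"
    by (intro vector_space_pair.intro vector_space_axioms vector_space_self)
  have "f y = 0" if "y \<in> (\<Inter>n. X n)" for y
  proof (rule linear_eq_0_on_span)
    show "Vector_Spaces.linear scale (*) f" using f(1) by (simp add: dual_space_def)
    show "y \<in> span B" using B that by simp
    show "f b = 0" if "b \<in> B" for b
      using f(2)[of b] that by (auto simp: T_def)
  qed
  then have "f \<in> perp scale (\<Inter>n. X n)" using f(1) by (simp add: perp_def)
  moreover have "f \<notin> perp scale (X n)" for n
  proof -
    obtain k where k: "n \<le> k" "k \<in> S" using S_unbounded by blast
    have "x k \<in> T (Suc k) 0" using k by (auto simp: T_def)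
    \<comment> \<open>\<open>B\<close> lies in every member of the chain, in particular in
      \<open>X (Suc k)\<close>; so \<open>x k\<close> receives the value 1 and not 0.\<close>
    moreover have "x k \<notin> B" using x(2)[OF k(2)] B(2) span_superset by fast
    ultimately have "f (x k) = 1" using f(2)[of "x k"] by auto
    moreover have "x k \<in> X n" using x(1)[OF k(2)] k(1) dec antimonoD by blast
    ultimately show ?thesis unfolding perp_def by force
  qed
  ultimately show thesis by (rule that)
qed

end

text \<open>Compose \<open>g\<close> with a linear \<open>r\<close> that inverts \<open>h\<close> on
  its range: \<open>r (h v)\<close> and \<open>v\<close> differ by an element of the kernel of
  \<open>h\<close>, where \<open>g\<close> vanishes.\<close>

lemma functional_factor:
  assumes h: "Vector_Spaces.linear s1 s2 h" and g: "g \<in> dual_space s1"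
    and ker: "\<And>v. h v = 0 \<Longrightarrow> g v = 0"
  obtains \<phi> where "\<phi> \<in> dual_space s2" "\<And>v. \<phi> (h v) = g v"
proof -
  interpret h: Vector_Spaces.linear s1 s2 h by fact
  interpret vector_space_pair s1 s2 ..
  obtain r where r: "Vector_Spaces.linear s2 s1 r" "\<And>v. h (r (h v)) = h v"
    using linear_exists_right_inverse_on[OF h, of UNIV] h.vs1.subspace_UNIV by auto
  have "g (r (h v) - v) = 0" for v
    by (rule ker) (simp add: h.diff r)
  then have "g (r (h v)) = g v" for v
    by (simp add: h.vs1.dual_space_diff[OF g])
  moreover have "(\<lambda>w. g (r w)) \<in> dual_space s2"
    using r(1) g by (simp add: Vector_Spaces.linear_iff h.vs1.dual_space_iff h.vs2.dual_space_iff)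
  ultimately show thesis by (rule that[rotated])
qed

section \<open>Linear maps out of tensor products\<close>

lemma lookup_free_scale: "Poly_Mapping.lookup (free_scale a p) x = a * Poly_Mapping.lookup p x"
  by (simp add: free_scale_def map.rep_eq when_def)

interpretation free: vector_space "free_scale :: 'k::field \<Rightarrow> ('x \<Rightarrow>\<^sub>0 'k) \<Rightarrow> ('x \<Rightarrow>\<^sub>0 'k)"
  by unfold_locales
    (auto intro!: poly_mapping_eqI simp: lookup_add lookup_free_scale algebra_simps)

lemma lin_ext_free_gen: "lin_ext free_scale gen p = p"
proof (rule poly_mapping_eqI)
  fix x
  show "Poly_Mapping.lookup (lin_ext free_scale gen p) x = Poly_Mapping.lookup p x"
    by (cases "x \<in> Poly_Mapping.keys p")
      (auto simp: lin_ext_def lookup_sum lookup_free_scale gen_def lookup_single when_def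
        in_keys_iff if_distrib sum.delta cong: if_cong)
qed

context vector_space
begin

lemma lin_ext_superset:
  assumes "finite A" "Poly_Mapping.keys p \<subseteq> A"
  shows "lin_ext scale \<phi> p = (\<Sum>x\<in>A. scale (Poly_Mapping.lookup p x) (\<phi> x))"
  unfolding lin_ext_def using assms by (intro sum.mono_neutral_left) (auto simp: in_keys_iff)

lemma lin_ext_linear: "Vector_Spaces.linear free_scale scale (lin_ext scale \<phi>)"
proof -
  have "lin_ext scale \<phi> (p + q) = lin_ext scale \<phi> p + lin_ext scale \<phi> q" for p q
  proof -
    let ?A = "Poly_Mapping.keys p \<union> Poly_Mapping.keys q"
    have "Poly_Mapping.keys (p + q) \<subseteq> ?A" by (rule keys_add)
    then show ?thesis
      by (simp add: lin_ext_superset[of ?A] lookup_add scale_left_distrib sum.distrib)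
  qed
  moreover have "lin_ext scale \<phi> (free_scale a p) = scale a (lin_ext scale \<phi> p)" for a p
  proof -
    have "Poly_Mapping.keys (free_scale a p) \<subseteq> Poly_Mapping.keys p"
      by (auto simp: in_keys_iff lookup_free_scale)
    then have "lin_ext scale \<phi> (free_scale a p) =
        (\<Sum>x\<in>Poly_Mapping.keys p. scale (Poly_Mapping.lookup (free_scale a p) x) (\<phi> x))"
      by (intro lin_ext_superset) simp_all
    then show ?thesis
      by (simp add: lin_ext_def lookup_free_scale scale_sum_right)
  qed
  ultimately show ?thesis
    by (simp add: Vector_Spaces.linear_iff free.vector_space_axioms vector_space_axioms)
qed

lemma lin_ext_gen: "lin_ext scale \<phi> (gen x) = \<phi> x"
  by (simp add: lin_ext_def gen_def)

lemma lin_ext_slot_relations: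
  assumes "Vector_Spaces.linear s scale (\<lambda>v. \<phi> (i v))" "r \<in> slot_relations s i"
  shows "lin_ext scale \<phi> r = 0"
proof -
  interpret l: Vector_Spaces.linear free_scale scale "lin_ext scale \<phi>" by (rule lin_ext_linear)
  show ?thesis
    using assms by (auto simp: slot_relations_def l.diff l.scale lin_ext_gen Vector_Spaces.linear_iff)
qed

end

lemma linear_lin_ext:
  assumes "Vector_Spaces.linear s1 s2 h"
  shows "h (lin_ext s1 \<phi> p) = lin_ext s2 (\<lambda>x. h (\<phi> x)) p"
proof -
  interpret h: Vector_Spaces.linear s1 s2 h by fact
  show ?thesis by (simp add: lin_ext_def h.sum h.scale)
qed

definition tensor_bilinear ::
  "('k::field \<Rightarrow> 'v::ab_group_add \<Rightarrow> 'v) \<Rightarrow> ('k \<Rightarrow> 'w::ab_group_add \<Rightarrow> 'w)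
    \<Rightarrow> ('k \<Rightarrow> 'u::ab_group_add \<Rightarrow> 'u) \<Rightarrow> ('v \<Rightarrow> 'w \<Rightarrow> 'u) \<Rightarrow> bool"
  where "tensor_bilinear sV sW sU \<beta> \<longleftrightarrow>
    (\<forall>w. Vector_Spaces.linear sV sU (\<lambda>v. \<beta> v w)) \<and> (\<forall>v. Vector_Spaces.linear sW sU (\<beta> v))"

text \<open>The well-definedness half of the universal property: by linearity only the generating
  relations count, and bilinearity kills each of them.\<close>

lemma lin_ext_tensor_relations:
  assumes \<beta>: "tensor_bilinear sV sW sU \<beta>" and r: "r \<in> tensor_relations sV sW"
  shows "lin_ext sU (\<lambda>(v, w). \<beta> v w) r = 0"
proof -
  interpret U: vector_space sU
    using \<beta> by (simp add: tensor_bilinear_def Vector_Spaces.linear_iff)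
  interpret l: Vector_Spaces.linear free_scale sU "lin_ext sU (\<lambda>(v, w). \<beta> v w)"
    by (rule U.lin_ext_linear)
  show ?thesis
  proof (rule l.eq_0_on_span[OF _ r[unfolded tensor_relations_def]])
    show "lin_ext sU (\<lambda>(v, w). \<beta> v w) x = 0"
      if "x \<in> (\<Union>w. slot_relations sV (\<lambda>v. (v, w))) \<union> (\<Union>v. slot_relations sW (\<lambda>w. (v, w)))" for x
      using that \<beta> by (auto simp: tensor_bilinear_def elim!: U.lin_ext_slot_relations[rotated])
  qed
qed

text \<open>The threefold analogue, for evaluating both sides of the coassociativity of the
  coaction.\<close>

lemma lin_ext_tensor3_relations:
  assumes \<tau>: "\<And>v w. Vector_Spaces.linear sU s (\<lambda>u. \<tau> (u, v, w))"
      "\<And>u w. Vector_Spaces.linear sV s (\<lambda>v. \<tau> (u, v, w))"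
      "\<And>u v. Vector_Spaces.linear sW s (\<lambda>w. \<tau> (u, v, w))"
    and r: "r \<in> tensor3_relations sU sV sW"
  shows "lin_ext s \<tau> r = 0"
proof -
  interpret s: vector_space s
    using \<tau>(1) by (simp add: Vector_Spaces.linear_iff)
  interpret l: Vector_Spaces.linear free_scale s "lin_ext s \<tau>"
    by (rule s.lin_ext_linear)
  show ?thesis
  proof (rule l.eq_0_on_span[OF _ r[unfolded tensor3_relations_def]])
    show "lin_ext s \<tau> x = 0"
      if "x \<in> (\<Union>v w. slot_relations sU (\<lambda>u. (u, v, w))) \<union>
        (\<Union>u w. slot_relations sV (\<lambda>v. (u, v, w))) \<union> (\<Union>u v. slot_relations sW (\<lambda>w. (u, v, w)))" for x
      using that \<tau> by (auto elim!: s.lin_ext_slot_relations[rotated])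
  qed
qed

section \<open>Tensors as cosets and the choice of representatives\<close>

lemma subspace_tensor_relations: "free.subspace (tensor_relations sV sW)"
  unfolding tensor_relations_def by (rule free.subspace_span)

lemma subspace_tensor3_relations: "free.subspace (tensor3_relations sU sV sW)"
  unfolding tensor3_relations_def by (rule free.subspace_span)

lemma slot_relations_add: "gen (i (v + w)) - gen (i v) - gen (i w) \<in> slot_relations s i"
  unfolding slot_relations_def by blast

lemma slot_relations_scale: "gen (i (s a v)) - free_scale a (gen (i v)) \<in> slot_relations s i"
  unfolding slot_relations_def by blast

lemma tensor_relations_slots:
  shows "gen (v + v', w) - gen (v, w) - gen (v', w) \<in> tensor_relations sV sW"
    and "gen (sV a v, w) - free_scale a (gen (v, w)) \<in> tensor_relations sV sW"
    and "gen (v, w + w') - gen (v, w) - gen (v, w') \<in> tensor_relations sV sW"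
    and "gen (v, sW a w) - free_scale a (gen (v, w)) \<in> tensor_relations sV sW"
proof -
  have 1: "r \<in> tensor_relations sV sW" if "r \<in> slot_relations sV (\<lambda>v. (v, w))" for r
    unfolding tensor_relations_def by (rule free.span_base) (use that in blast)
  have 2: "r \<in> tensor_relations sV sW" if "r \<in> slot_relations sW (Pair v)" for r
    unfolding tensor_relations_def by (rule free.span_base) (use that in blast)
  show "gen (v + v', w) - gen (v, w) - gen (v', w) \<in> tensor_relations sV sW"
    using slot_relations_add[of "\<lambda>v. (v, w)"] by (rule 1)
  show "gen (sV a v, w) - free_scale a (gen (v, w)) \<in> tensor_relations sV sW"
    using slot_relations_scale[of "\<lambda>v. (v, w)"] by (rule 1)
  show "gen (v, w + w') - gen (v, w) - gen (v, w') \<in> tensor_relations sV sW"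
    using slot_relations_add[of "Pair v"] by (rule 2)
  show "gen (v, sW a w) - free_scale a (gen (v, w)) \<in> tensor_relations sV sW"
    using slot_relations_scale[of "Pair v"] by (rule 2)
qed

lemma in_coset_self: "free.subspace R \<Longrightarrow> p \<in> coset R p"
  by (simp add: coset_def free.subspace_0)

lemma rep_in:
  assumes R: "free.subspace R" and X: "X \<in> quotient_space R"
  shows "rep X \<in> X"
proof -
  obtain p where "X = coset R p" using X unfolding quotient_space_def by blast
  then have "p \<in> X" using in_coset_self[OF R] by simp
  then show ?thesis unfolding rep_def by (rule someI)
qed

lemma quotient_space_diff:
  assumes R: "free.subspace R" and X: "X \<in> quotient_space R" and p: "p \<in> X"
  shows "q \<in> X \<longleftrightarrow> q - p \<in> R"
proof -
  obtain r where r: "X = coset R r" using X unfolding quotient_space_def by blast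
  then have "p - r \<in> R" using p by (simp add: coset_def)
  with r show ?thesis
    using free.subspace_diff[OF R, of "q - r" "p - r"] free.subspace_add[OF R, of "q - p" "p - r"]
    by (auto simp: coset_def)
qed

text \<open>Two representatives differ by a relation, on which the extension vanishes; so the choice
  made by \<open>rep\<close> does not affect such values.\<close>

lemma lin_ext_tensor_rep:
  assumes X: "X \<in> quotient_space (tensor_relations sV sW)"
    and \<beta>: "tensor_bilinear sV sW sU \<beta>" and p: "p \<in> X"
  shows "lin_ext sU (\<lambda>(v, w). \<beta> v w) (rep X) = lin_ext sU (\<lambda>(v, w). \<beta> v w) p"
proof -
  interpret U: vector_space sU
    using \<beta> by (simp add: tensor_bilinear_def Vector_Spaces.linear_iff)
  interpret l: Vector_Spaces.linear free_scale sU "lin_ext sU (\<lambda>(v, w). \<beta> v w)"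
    by (rule U.lin_ext_linear)
  have "rep X - p \<in> tensor_relations sV sW"
    using quotient_space_diff[OF subspace_tensor_relations X p] rep_in[OF subspace_tensor_relations X]
    by simp
  from lin_ext_tensor_relations[OF \<beta> this] show ?thesis
    by (simp add: l.diff)
qed

text \<open>\<open>rep\<close> need not be additive, but the sum of representatives of
  \<open>F x\<close> and \<open>F y\<close> represents \<open>F (x + y)\<close>, and only the coset
  matters.\<close>

lemma linear_to_quotient_lift:
  assumes s: "vector_space s" and F: "linear_to_quotient s (tensor_relations sV sW) F"
    and \<beta>: "tensor_bilinear sV sW sU \<beta>"
  shows "Vector_Spaces.linear s sU (\<lambda>x. lin_ext sU (\<lambda>(v, w). \<beta> v w) (rep (F x)))"
proof -
  interpret U: vector_space sU
    using \<beta> by (simp add: tensor_bilinear_def Vector_Spaces.linear_iff)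
  interpret l: Vector_Spaces.linear free_scale sU "lin_ext sU (\<lambda>(v, w). \<beta> v w)"
    by (rule U.lin_ext_linear)
  have Fq: "F x \<in> quotient_space (tensor_relations sV sW)" for x
    using F by (simp add: linear_to_quotient_def)
  have r: "rep (F x) \<in> F x" for x
    by (rule rep_in[OF subspace_tensor_relations Fq])
  have 1: "rep (F x) + rep (F y) \<in> F (x + y)" for x y
    using F r by (simp add: linear_to_quotient_def)
  have 2: "free_scale a (rep (F x)) \<in> F (s a x)" for a x
    using F r by (simp add: linear_to_quotient_def)
  show ?thesis
    by (simp add: Vector_Spaces.linear_iff s U.vector_space_axioms
        lin_ext_tensor_rep[OF Fq \<beta> 1] lin_ext_tensor_rep[OF Fq \<beta> 2] l.add l.scale)
qed

text \<open>The identity \<open>t = \<Sum>\<^sub>b b \<otimes> (\<delta>\<^sub>b \<otimes> id)(t)\<close> in the tensor product, for \<open>t\<close> in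
  \<open>span B \<otimes> W\<close> and \<open>\<delta>\<close> dual to the basis \<open>B\<close>.\<close>

lemma tensor_dual_basis:
  assumes V: "vector_space sV" and W: "vector_space sW" and "finite B"
    and \<delta>: "\<And>b. b \<in> B \<Longrightarrow> \<delta> b \<in> dual_space sV"
      "\<And>b b'. b \<in> B \<Longrightarrow> b' \<in> B \<Longrightarrow> \<delta> b b' = (if b' = b then 1 else 0)"
    and p: "Poly_Mapping.keys p \<subseteq> module.span sV B \<times> UNIV"
  shows "(\<Sum>b\<in>B. gen (b, lin_ext sW (\<lambda>(v, w). sW (\<delta> b v) w) p)) - p \<in> tensor_relations sV sW"
proof -
  interpret V: vector_space sV by fact
  interpret W: vector_space sW by fact
  let ?R = "tensor_relations sV sW"
  define L where "L b = lin_ext sW (\<lambda>(v, w). sW (\<delta> b v) w)" for b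
  \<comment> \<open>\<open>D\<close> collects the formal sums that satisfy the identity. It is a
    subspace, is closed under congruence modulo the relations and contains the generators over
    \<open>span B\<close>; hence it contains \<open>p\<close>.\<close>
  define D where "D = {q. (\<Sum>b\<in>B. gen (b, L b q)) - q \<in> ?R}"
  note R = subspace_tensor_relations[of sV sW]
  have L_lin: "Vector_Spaces.linear free_scale sW (L b)" for b
    unfolding L_def by (rule W.lin_ext_linear)
  then have L_add: "L b (q + q') = L b q + L b q'" and L_scale: "L b (free_scale a q) = sW a (L b q)"
    and L_gen: "L b (gen (v, w)) = sW (\<delta> b v) w" for b q q' a v w
    by (simp_all add: Vector_Spaces.linear_iff L_def W.lin_ext_gen)
  have L_R: "L b r = 0" if "r \<in> ?R" "b \<in> B" for b r
    unfolding L_def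
  proof (rule lin_ext_tensor_relations[OF _ that(1)])
    show "tensor_bilinear sV sW sW (\<lambda>v. sW (\<delta> b v))"
      using \<delta>(1)[OF that(2)]
      by (auto simp: tensor_bilinear_def Vector_Spaces.linear_iff V W V.dual_space_iff
          W.scale_right_distrib W.scale_left_distrib mult.commute)
  qed
  \<comment> \<open>\<open>gen (b, 0)\<close> is a nonzero formal sum and vanishes only as a tensor:
    pull the scalar 0 out of the slot.\<close>
  have gen0: "gen (b, 0) \<in> ?R" "gen (0, w) \<in> ?R" for b w
    using tensor_relations_slots(4)[of b sW 0 0 sV] tensor_relations_slots(2)[of sV 0 0 w sW] by simp_all
  have D_subspace: "free.subspace D"
  proof (rule free.subspaceI)
    have "L b 0 = 0" for b using L_scale[of b 0 0] by simp
    then show "0 \<in> D" by (simp add: D_def free.subspace_sum[OF R] gen0)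
  next
    fix q q' assume q: "q \<in> D" "q' \<in> D"
    have "(\<Sum>b\<in>B. gen (b, L b (q + q'))) - (q + q') =
      (\<Sum>b\<in>B. gen (b, L b q + L b q') - gen (b, L b q) - gen (b, L b q')) +
      (((\<Sum>b\<in>B. gen (b, L b q)) - q) + ((\<Sum>b\<in>B. gen (b, L b q')) - q'))"
      by (simp add: L_add sum_subtractf)
    also have "\<dots> \<in> ?R"
      using q by (intro free.subspace_add[OF R] free.subspace_sum[OF R] tensor_relations_slots(3))
        (simp_all add: D_def)
    finally show "q + q' \<in> D" by (simp add: D_def)
  next
    fix a q assume q: "q \<in> D"
    have "(\<Sum>b\<in>B. gen (b, L b (free_scale a q))) - free_scale a q =
      (\<Sum>b\<in>B. gen (b, sW a (L b q)) - free_scale a (gen (b, L b q))) +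
      free_scale a ((\<Sum>b\<in>B. gen (b, L b q)) - q)"
      by (simp add: L_scale sum_subtractf free.scale_sum_right free.scale_right_diff_distrib)
    also have "\<dots> \<in> ?R"
      using q by (intro free.subspace_add[OF R] free.subspace_sum[OF R] free.subspace_scale[OF R]
          tensor_relations_slots(4)) (simp add: D_def)
    finally show "free_scale a q \<in> D" by (simp add: D_def)
  qed
  have D_cong: "q \<in> D" if "q' \<in> D" "q - q' \<in> ?R" for q q'
  proof -
    have "L b q = L b q'" if "b \<in> B" for b
      using L_add[of b "q - q'" q'] L_R[OF \<open>q - q' \<in> ?R\<close> that] by simp
    then have "(\<Sum>b\<in>B. gen (b, L b q)) - q = ((\<Sum>b\<in>B. gen (b, L b q')) - q') - (q - q')"
      by simp
    also have "\<dots> \<in> ?R"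
      by (rule free.subspace_diff[OF R _ that(2)]) (use that(1) in \<open>simp add: D_def\<close>)
    finally show ?thesis by (simp add: D_def)
  qed
  have "gen (v, w) \<in> D" if "v \<in> V.span B" for v w
    using that
  proof (induction rule: V.span_induct)
    case base
    show ?case
    proof (rule V.subspaceI)
      show "0 \<in> {v. gen (v, w) \<in> D}"
        using D_cong[of 0 "gen (0, w)"] free.subspace_0[OF D_subspace] gen0 by simp
    next
      fix x y assume "x \<in> {v. gen (v, w) \<in> D}" "y \<in> {v. gen (v, w) \<in> D}"
      then have "gen (x, w) + gen (y, w) \<in> D" by (simp add: free.subspace_add[OF D_subspace])
      from D_cong[OF this, of "gen (x + y, w)"] show "x + y \<in> {v. gen (v, w) \<in> D}"
        using tensor_relations_slots(1)[of x y w sV sW] by (simp add: diff_diff_eq)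
    next
      fix a x assume "x \<in> {v. gen (v, w) \<in> D}"
      then have "free_scale a (gen (x, w)) \<in> D" by (simp add: free.subspace_scale[OF D_subspace])
      from D_cong[OF this, of "gen (sV a x, w)"] show "sV a x \<in> {v. gen (v, w) \<in> D}"
        using tensor_relations_slots(2)[of sV a x w sW] by simp
    qed
  next
    case (step b)
    \<comment> \<open>For a basis vector \<open>b\<close>, duality leaves the term of
      \<open>b\<close> itself; all others become \<open>gen (b', 0)\<close>, which are
      relations.\<close>
    have "(\<Sum>b'\<in>B - {b}. gen (b', L b' (gen (b, w)))) = (\<Sum>b'\<in>B - {b}. gen (b', 0))"
      using step by (intro sum.cong) (auto simp: L_gen \<delta>(2))
    then have "(\<Sum>b'\<in>B. gen (b', L b' (gen (b, w)))) - gen (b, w) = (\<Sum>b'\<in>B - {b}. gen (b', 0))"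
      using step \<open>finite B\<close> by (simp add: L_gen \<delta>(2) sum.remove[of B b])
    also have "\<dots> \<in> ?R" by (intro free.subspace_sum[OF R] gen0)
    finally show ?case by (simp add: D_def)
  qed
  then have "lin_ext free_scale gen p \<in> D"
    unfolding lin_ext_def using p
    by (intro free.subspace_sum[OF D_subspace] free.subspace_scale[OF D_subspace]) auto
  then show ?thesis by (simp add: lin_ext_free_gen D_def L_def)
qed

section \<open>Comodules as modules over the dual algebra\<close>

context left_comodule
begin

abbreviation act :: "'m \<Rightarrow> ('c \<Rightarrow> 'k) \<Rightarrow> 'm" (infixl "\<triangleleft>" 70)
  where "m \<triangleleft> \<phi> \<equiv> right_action sM \<rho> m \<phi>"

lemma coact_quotient: "\<rho> m \<in> quotient_space (tensor_relations sC sM)"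
  using coact_linear by (simp add: linear_to_quotient_def)

lemma counit_dual: "\<epsilon> \<in> dual_space sC"
  using counit_linear by (simp add: dual_space_def)

lemma act_bilinear:
  assumes "\<phi> \<in> dual_space sC"
  shows "tensor_bilinear sC sM sM (\<lambda>x. sM (\<phi> x))"
  using assms by (auto simp: tensor_bilinear_def Vector_Spaces.linear_iff dual_space_iff
      vector_space_axioms M.vector_space_axioms M.scale_left_distrib M.scale_right_distrib mult.commute)

lemma convolution_bilinear:
  assumes "\<phi> \<in> dual_space sC" "\<psi> \<in> dual_space sC"
  shows "tensor_bilinear sC sC (*) (\<lambda>x y. \<phi> x * \<psi> y)"
  using assms by (auto simp: tensor_bilinear_def Vector_Spaces.linear_iff dual_space_iff
      vector_space_axioms vector_space_self algebra_simps)

lemma act_linear: "\<phi> \<in> dual_space sC \<Longrightarrow> Vector_Spaces.linear sM sM (\<lambda>m. m \<triangleleft> \<phi>)"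
  unfolding right_action_def
  by (rule linear_to_quotient_lift[OF M.vector_space_axioms coact_linear act_bilinear])

lemma act_add_left: "\<phi> \<in> dual_space sC \<Longrightarrow> (m + n) \<triangleleft> \<phi> = m \<triangleleft> \<phi> + n \<triangleleft> \<phi>"
  and act_scale_left: "\<phi> \<in> dual_space sC \<Longrightarrow> sM a m \<triangleleft> \<phi> = sM a (m \<triangleleft> \<phi>)"
  using act_linear by (simp_all add: Vector_Spaces.linear_iff)

lemma act_add_right: "m \<triangleleft> (\<lambda>c. \<phi> c + \<psi> c) = m \<triangleleft> \<phi> + m \<triangleleft> \<psi>"
  by (simp add: right_action_def lin_ext_def case_prod_unfold M.scale_left_distrib
      M.scale_right_distrib sum.distrib)

lemma act_scale_right: "m \<triangleleft> (\<lambda>c. a * \<phi> c) = sM a (m \<triangleleft> \<phi>)"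
  by (simp add: right_action_def lin_ext_def case_prod_unfold M.scale_sum_right mult.left_commute)

lemma act_counit: "m \<triangleleft> \<epsilon> = m"
  using coact_counit by (simp add: right_action_def)

lemma act_rep:
  assumes "\<phi> \<in> dual_space sC" "p \<in> \<rho> m"
  shows "m \<triangleleft> \<phi> = lin_ext sM (\<lambda>(x, n). sM (\<phi> x) n) p"
  unfolding right_action_def
  by (rule lin_ext_tensor_rep[OF coact_quotient act_bilinear[OF assms(1)] assms(2)])

lemma convolution_dual:
  assumes "\<phi> \<in> dual_space sC" "\<psi> \<in> dual_space sC"
  shows "convolution \<Delta> \<phi> \<psi> \<in> dual_space sC"
  using linear_to_quotient_lift[OF vector_space_axioms comult_linear convolution_bilinear[OF assms]]
  by (simp add: dual_space_def convolution_def[abs_def])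

text \<open>Both sides evaluate the trilinear map \<open>\<tau>\<close> on a threefold tensor:
  \<open>tensor_right\<close> expands to acting twice, \<open>tensor_left\<close> to the
  convolution, and coassociativity identifies the two.\<close>

lemma act_act:
  assumes \<phi>: "\<phi> \<in> dual_space sC" and \<psi>: "\<psi> \<in> dual_space sC"
  shows "m \<triangleleft> \<phi> \<triangleleft> \<psi> = m \<triangleleft> convolution \<Delta> \<phi> \<psi>"
proof -
  define \<tau> where "\<tau> = (\<lambda>(x, y, n). sM (\<phi> x * \<psi> y) n)"
  interpret l: Vector_Spaces.linear free_scale sM "lin_ext sM \<tau>"
    by (rule M.lin_ext_linear)
  let ?l = "tensor_left \<Delta> (rep (\<rho> m))" and ?r = "tensor_right \<rho> (rep (\<rho> m))"
  have "?r \<in> coset (tensor3_relations sC sC sM) ?l"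
    using coact_coassoc in_coset_self[OF subspace_tensor3_relations] by metis
  then have "?r - ?l \<in> tensor3_relations sC sC sM"
    by (simp add: coset_def)
  then have "lin_ext sM \<tau> (?r - ?l) = 0"
    by (rule lin_ext_tensor3_relations[rotated -1])
      (use \<phi> \<psi> in \<open>auto simp: \<tau>_def Vector_Spaces.linear_iff dual_space_iff vector_space_axioms
        M.vector_space_axioms M.scale_left_distrib M.scale_right_distrib algebra_simps\<close>)
  then have eq: "lin_ext sM \<tau> ?r = lin_ext sM \<tau> ?l"
    by (simp add: l.diff)
  have "lin_ext sM \<tau> ?r = lin_ext sM (\<lambda>(x, n). sM (\<phi> x) (n \<triangleleft> \<psi>)) (rep (\<rho> m))"
    by (simp add: tensor_right_def linear_lin_ext[OF M.lin_ext_linear] case_prod_unfold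
        M.lin_ext_gen \<tau>_def right_action_def linear_lin_ext[OF M.linear_scale_self])
  also have "\<dots> = m \<triangleleft> \<phi> \<triangleleft> \<psi>"
    unfolding right_action_def[of sM \<rho> m]
    by (simp add: linear_lin_ext[OF act_linear[OF \<psi>]] case_prod_unfold act_scale_left[OF \<psi>])
  finally have r: "lin_ext sM \<tau> ?r = m \<triangleleft> \<phi> \<triangleleft> \<psi>" .
  have lin: "Vector_Spaces.linear (*) sM (\<lambda>a. sM a n)" for n
    by (simp add: Vector_Spaces.linear_iff vector_space_self M.vector_space_axioms M.scale_left_distrib)
  have "lin_ext sM \<tau> ?l = lin_ext sM (\<lambda>(x, n). sM (convolution \<Delta> \<phi> \<psi> x) n) (rep (\<rho> m))"
    by (simp add: tensor_left_def linear_lin_ext[OF M.lin_ext_linear] case_prod_unfold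
        M.lin_ext_gen \<tau>_def convolution_def linear_lin_ext[OF lin])
  then show ?thesis
    using eq r by (simp add: right_action_def)
qed

text \<open>A tensor lies in \<open>C \<otimes> X\<close> once its contractions by functionals on
  \<open>C\<close> lie in \<open>X\<close>: expand it along a basis of its left components; the
  right components become contractions by dual functionals.\<close>

lemma subcomodule_iff:
  "subcomodule sM \<rho> X \<longleftrightarrow> M.subspace X \<and> (\<forall>x\<in>X. \<forall>\<phi>\<in>dual_space sC. x \<triangleleft> \<phi> \<in> X)"
proof
  assume X: "subcomodule sM \<rho> X"
  then have sub: "M.subspace X" by (simp add: subcomodule_def)
  have "x \<triangleleft> \<phi> \<in> X" if x: "x \<in> X" and \<phi>: "\<phi> \<in> dual_space sC" for x \<phi>
  proof -
    obtain p where p: "p \<in> \<rho> x" "Poly_Mapping.keys p \<subseteq> UNIV \<times> X"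
      using X x by (auto simp: subcomodule_def)
    show ?thesis
      unfolding act_rep[OF \<phi> p(1)] lin_ext_def
      using p(2) by (intro M.subspace_sum[OF sub]) (auto intro!: M.subspace_scale[OF sub])
  qed
  with sub show "M.subspace X \<and> (\<forall>x\<in>X. \<forall>\<phi>\<in>dual_space sC. x \<triangleleft> \<phi> \<in> X)" by blast
next
  assume X: "M.subspace X \<and> (\<forall>x\<in>X. \<forall>\<phi>\<in>dual_space sC. x \<triangleleft> \<phi> \<in> X)"
  have "\<exists>p\<in>\<rho> x. Poly_Mapping.keys p \<subseteq> UNIV \<times> X" if x: "x \<in> X" for x
  proof -
    define p where "p = rep (\<rho> x)"
    have p: "p \<in> \<rho> x"
      unfolding p_def by (rule rep_in[OF subspace_tensor_relations coact_quotient])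
    \<comment> \<open>Taking \<open>B\<close> among the finitely many left components of
      \<open>p\<close> makes it finite, whatever the dimension of \<open>C\<close>.\<close>
    obtain B where B: "B \<subseteq> fst ` Poly_Mapping.keys p" "independent B"
        "fst ` Poly_Mapping.keys p \<subseteq> span B"
      using maximal_independent_subset .
    have "\<exists>f. f \<in> dual_space sC \<and> (\<forall>b'\<in>B. f b' = (if b' = b then 1 else 0))" for b
      by (rule dual_space_extend[OF B(2), of "\<lambda>b'. if b' = b then 1 else 0"]) blast
    then obtain \<delta> where \<delta>: "\<And>b. \<delta> b \<in> dual_space sC"
        "\<And>b b'. b' \<in> B \<Longrightarrow> \<delta> b b' = (if b' = b then 1 else 0)"
      by metis
    \<comment> \<open>A second representative of \<open>\<rho> x\<close>, whose right components
      \<open>x \<triangleleft> \<delta> b\<close> lie in \<open>X\<close> by stability.\<close>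
    define q :: "'c \<times> 'm \<Rightarrow>\<^sub>0 'k" where "q = (\<Sum>b\<in>B. gen (b, x \<triangleleft> \<delta> b))"
    have "q - p \<in> tensor_relations sC sM"
      unfolding q_def act_rep[OF \<delta>(1) p]
    proof (rule tensor_dual_basis[OF vector_space_axioms M.vector_space_axioms])
      show "finite B" using B(1) by (rule finite_subset) simp
      show "Poly_Mapping.keys p \<subseteq> span B \<times> UNIV" using B(3) by force
    qed (simp_all add: \<delta>)
    then have "q \<in> \<rho> x"
      using quotient_space_diff[OF subspace_tensor_relations coact_quotient p] by simp
    moreover have "Poly_Mapping.keys (gen (b, x \<triangleleft> \<delta> b)) \<subseteq> UNIV \<times> X" for b
      using X x \<delta>(1) by (simp add: gen_def)
    then have "Poly_Mapping.keys q \<subseteq> UNIV \<times> X"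
      unfolding q_def by (intro order_trans[OF Poly_Mapping.keys_sum] UN_least)
    ultimately show ?thesis by blast
  qed
  with X show "subcomodule sM \<rho> X" by (simp add: subcomodule_def)
qed

section \<open>Finite dimensional subcomodules and local finiteness\<close>

lemma subcomodule_UNIV: "subcomodule sM \<rho> UNIV"
  by (simp add: subcomodule_iff)

lemma subcomodule_subspace: "subcomodule sM \<rho> X \<Longrightarrow> M.subspace X"
  by (simp add: subcomodule_iff)

lemma subcomodule_Int:
  "subcomodule sM \<rho> X \<Longrightarrow> subcomodule sM \<rho> Y \<Longrightarrow> subcomodule sM \<rho> (X \<inter> Y)"
  by (simp add: subcomodule_iff M.subspace_inter)

lemma finite_dim_subcomodule_zero: "finite_dim_subcomodule sM \<rho> {0}"
proof -
  have "0 \<triangleleft> \<phi> = 0" if "\<phi> \<in> dual_space sC" for \<phi>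
    using act_scale_left[OF that, of 0 0] by simp
  then show ?thesis
    unfolding finite_dim_subcomodule_def subcomodule_iff
    by (auto intro!: exI[of _ "{}"])
qed

text \<open>The witness is the sum of the two. Directedness of this family gives a basic
  neighborhood inside the intersection of two.\<close>

lemma finite_dim_subcomodule_sum:
  assumes "finite_dim_subcomodule sM \<rho> X" "finite_dim_subcomodule sM \<rho> Y"
  obtains Z where "finite_dim_subcomodule sM \<rho> Z" "X \<subseteq> Z" "Y \<subseteq> Z"
proof -
  obtain B D where B: "finite B" "X = M.span B" and D: "finite D" "Y = M.span D"
    using assms by (auto simp: finite_dim_subcomodule_def)
  have Z: "M.span (B \<union> D) = {x + y |x y. x \<in> X \<and> y \<in> Y}"
    unfolding B D by (rule M.span_Un)
  have "subcomodule sM \<rho> (M.span (B \<union> D))"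
    unfolding subcomodule_iff
  proof (intro conjI ballI M.subspace_span)
    fix z \<phi> assume z: "z \<in> M.span (B \<union> D)" and \<phi>: "\<phi> \<in> dual_space sC"
    then obtain x y where "x \<in> X" "y \<in> Y" "z = x + y" using Z by blast
    then have "x \<triangleleft> \<phi> \<in> X" "y \<triangleleft> \<phi> \<in> Y" "z \<triangleleft> \<phi> = x \<triangleleft> \<phi> + y \<triangleleft> \<phi>"
      using assms \<phi> by (simp_all add: finite_dim_subcomodule_def subcomodule_iff act_add_left)
    then show "z \<triangleleft> \<phi> \<in> M.span (B \<union> D)" unfolding Z by blast
  qed
  then have "finite_dim_subcomodule sM \<rho> (M.span (B \<union> D))"
    using B(1) D(1) by (auto simp: finite_dim_subcomodule_def)
  then show thesis
    by (rule that) (simp_all add: B D M.span_mono)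
qed

text \<open>Local finiteness of comodules: the orbit of \<open>m\<close> under the dual algebra
  contains \<open>m\<close> by the counit, and lies in the span of the finitely many right
  components of a representative of \<open>\<rho> m\<close>.\<close>

lemma finite_dim_subcomodule_containing:
  obtains X where "finite_dim_subcomodule sM \<rho> X" "m \<in> X"
proof -
  define X where "X = {m \<triangleleft> \<phi> |\<phi>. \<phi> \<in> dual_space sC}"
  define W where "W = snd ` Poly_Mapping.keys (rep (\<rho> m))"
  have "M.subspace X"
  proof (rule M.subspaceI)
    have "(\<lambda>c. 0 * \<epsilon> c) \<in> dual_space sC" by (simp add: dual_space_iff)
    then show "0 \<in> X" unfolding X_def using act_scale_right[of m 0 \<epsilon>] by force
  next
    fix x y assume "x \<in> X" "y \<in> X"
    then obtain \<phi> \<psi> where *: "x = m \<triangleleft> \<phi>" "\<phi> \<in> dual_space sC" "y = m \<triangleleft> \<psi>" "\<psi> \<in> dual_space sC"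
      by (auto simp: X_def)
    then have "x + y = m \<triangleleft> (\<lambda>c. \<phi> c + \<psi> c)" "(\<lambda>c. \<phi> c + \<psi> c) \<in> dual_space sC"
      by (simp_all add: act_add_right dual_space_iff algebra_simps)
    then show "x + y \<in> X" unfolding X_def by blast
  next
    fix a x assume "x \<in> X"
    then obtain \<phi> where *: "x = m \<triangleleft> \<phi>" "\<phi> \<in> dual_space sC"
      by (auto simp: X_def)
    then have "sM a x = m \<triangleleft> (\<lambda>c. a * \<phi> c)" "(\<lambda>c. a * \<phi> c) \<in> dual_space sC"
      by (simp_all add: act_scale_right dual_space_iff algebra_simps)
    then show "sM a x \<in> X" unfolding X_def by blast
  qed
  moreover have "x \<triangleleft> \<psi> \<in> X" if "x \<in> X" "\<psi> \<in> dual_space sC" for x \<psi>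
    using that act_act convolution_dual unfolding X_def by blast
  ultimately have X: "subcomodule sM \<rho> X" by (simp add: subcomodule_iff)
  have W: "n \<in> M.span W" if "(c, n) \<in> Poly_Mapping.keys (rep (\<rho> m))" for c n
    by (rule M.span_base) (use that in \<open>force simp: W_def\<close>)
  have "x \<in> M.span W" if "x \<in> X" for x
    using that unfolding X_def right_action_def lin_ext_def
    by (auto intro!: M.span_sum M.span_scale intro: W)
  then have "X \<subseteq> M.span W" ..
  \<comment> \<open>\<open>W\<close> need not lie in \<open>X\<close>; the finite generating set is
    a basis of \<open>X\<close>, whose size \<open>W\<close> bounds.\<close>
  moreover obtain B where B: "M.independent B" "M.span B = X"
    using M.basis_of_subspace subcomodule_subspace[OF X] .
  ultimately have "finite B"
    using M.independent_span_bound[of W B] M.span_superset[of B] by (auto simp: W_def)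
  with X B have "finite_dim_subcomodule sM \<rho> X" by (auto simp: finite_dim_subcomodule_def)
  moreover have "m \<in> X"
    unfolding X_def using act_counit[of m] counit_dual by force
  ultimately show thesis by (rule that)
qed

section \<open>The finite topology: open and closed sets\<close>

lemma perp_antimono: "X \<subseteq> Y \<Longrightarrow> perp sM Y \<subseteq> perp sM X"
  by (auto simp: perp_def)

lemma openin_finite_topology: "openin (finite_topology sM \<rho>) U \<longleftrightarrow> finite_topology_open sM \<rho> U"
proof -
  have "istopology (finite_topology_open sM \<rho>)"
    unfolding istopology_def
  proof (intro conjI allI impI)
    fix U V assume UV: "finite_topology_open sM \<rho> U" "finite_topology_open sM \<rho> V"
    show "finite_topology_open sM \<rho> (U \<inter> V)"
      unfolding finite_topology_open_def
    proof (intro conjI ballI)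
      fix f assume f: "f \<in> U \<inter> V"
      obtain X where X: "finite_dim_subcomodule sM \<rho> X" "{\<lambda>m. f m + g m | g. g \<in> perp sM X} \<subseteq> U"
        using UV(1) f unfolding finite_topology_open_def by blast
      obtain Y where Y: "finite_dim_subcomodule sM \<rho> Y" "{\<lambda>m. f m + g m | g. g \<in> perp sM Y} \<subseteq> V"
        using UV(2) f unfolding finite_topology_open_def by blast
      obtain Z where Z: "finite_dim_subcomodule sM \<rho> Z" "X \<subseteq> Z" "Y \<subseteq> Z"
        using finite_dim_subcomodule_sum[OF X(1) Y(1)] .
      show "\<exists>Z. finite_dim_subcomodule sM \<rho> Z \<and> {\<lambda>m. f m + g m | g. g \<in> perp sM Z} \<subseteq> U \<inter> V"
        using X(2) Y(2) Z(1) perp_antimono[OF Z(2)] perp_antimono[OF Z(3)]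
        by (intro exI[of _ Z]) blast
    qed (use UV in \<open>auto simp: finite_topology_open_def\<close>)
  next
    fix \<K> assume \<K>: "\<forall>K\<in>\<K>. finite_topology_open sM \<rho> K"
    show "finite_topology_open sM \<rho> (\<Union>\<K>)"
      unfolding finite_topology_open_def
    proof (intro conjI ballI)
      fix f assume "f \<in> \<Union>\<K>"
      then obtain K where K: "K \<in> \<K>" "f \<in> K" by blast
      then obtain X where "finite_dim_subcomodule sM \<rho> X" "{\<lambda>m. f m + g m | g. g \<in> perp sM X} \<subseteq> K"
        using \<K> unfolding finite_topology_open_def by blast
      then show "\<exists>X. finite_dim_subcomodule sM \<rho> X \<and> {\<lambda>m. f m + g m | g. g \<in> perp sM X} \<subseteq> \<Union>\<K>"
        using K(1) by (intro exI[of _ X]) blast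
    qed (use \<K> in \<open>auto simp: finite_topology_open_def\<close>)
  qed
  then show ?thesis by (simp add: finite_topology_def)
qed

lemma topspace_finite_topology: "topspace (finite_topology sM \<rho>) = dual_space sM"
proof
  show "topspace (finite_topology sM \<rho>) \<subseteq> dual_space sM"
    using openin_topspace[of "finite_topology sM \<rho>"] unfolding openin_finite_topology finite_topology_open_def by blast
  have "finite_topology_open sM \<rho> (dual_space sM)"
    unfolding finite_topology_open_def using finite_dim_subcomodule_zero
    by (auto simp: perp_def M.dual_space_iff algebra_simps intro!: exI[of _ "{0}"])
  then show "dual_space sM \<subseteq> topspace (finite_topology sM \<rho>)"
    by (simp add: openin_subset openin_finite_topology)
qed

lemma closedin_finite_topology:
  "closedin (finite_topology sM \<rho>) N \<longleftrightarrow> N \<subseteq> dual_space sM \<and>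
    (\<forall>f\<in>dual_space sM - N. \<exists>X. finite_dim_subcomodule sM \<rho> X \<and>
      (\<forall>g\<in>perp sM X. (\<lambda>m. f m + g m) \<notin> N))"
proof -
  have "(\<lambda>m. f m + g m) \<in> dual_space sM" if "f \<in> dual_space sM" "g \<in> perp sM X" for f g X
    using that by (simp add: perp_def M.dual_space_iff algebra_simps)
  then have "{\<lambda>m. f m + g m | g. g \<in> perp sM X} \<subseteq> dual_space sM - N \<longleftrightarrow>
      (\<forall>g\<in>perp sM X. (\<lambda>m. f m + g m) \<notin> N)" if "f \<in> dual_space sM" for f X
    using that by auto
  then show ?thesis
    by (simp add: closedin_def openin_finite_topology topspace_finite_topology finite_topology_open_def)
qed

text \<open>If \<open>f\<close> is nonzero at \<open>x \<in> X\<close>, adding functionals that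
  vanish on a finite dimensional subcomodule containing \<open>x\<close> keeps the value at
  \<open>x\<close>, so a whole neighborhood of \<open>f\<close> avoids
  \<open>perp sM X\<close>.\<close>

lemma closedin_perp: "closedin (finite_topology sM \<rho>) (perp sM X)"
  unfolding closedin_finite_topology
proof (intro conjI ballI)
  fix f assume "f \<in> dual_space sM - perp sM X"
  then obtain x where x: "x \<in> X" "f x \<noteq> 0" by (auto simp: perp_def)
  obtain Y where "finite_dim_subcomodule sM \<rho> Y" "x \<in> Y"
    by (rule finite_dim_subcomodule_containing)
  with x show "\<exists>Y. finite_dim_subcomodule sM \<rho> Y \<and> (\<forall>g\<in>perp sM Y. (\<lambda>m. f m + g m) \<notin> perp sM X)"
    by (intro exI[of _ Y]) (auto simp: perp_def intro!: bexI[of _ x])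
qed (simp add: perp_def)

section \<open>Submodules of the dual module\<close>

lemma submodule_iff:
  "submodule N (dual_algebra sC \<Delta> \<epsilon>) (dual_module sM \<rho>) \<longleftrightarrow>
    N \<subseteq> dual_space sM \<and> (\<lambda>m. 0) \<in> N \<and> (\<forall>f\<in>N. \<forall>g\<in>N. (\<lambda>m. f m + g m) \<in> N) \<and>
    (\<forall>\<phi>\<in>dual_space sC. \<forall>f\<in>N. (\<lambda>m. f (m \<triangleleft> \<phi>)) \<in> N)" (is "_ = ?rhs")
proof
  assume "submodule N (dual_algebra sC \<Delta> \<epsilon>) (dual_module sM \<rho>)"
  then interpret submodule N "dual_algebra sC \<Delta> \<epsilon>" "dual_module sM \<rho>" .
  show ?rhs
    using subset m_closed one_closed smult_closed by (simp add: dual_module_def dual_algebra_def)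
next
  assume N: ?rhs
  let ?G = "add_monoid (dual_module sM \<rho>)"
  show "submodule N (dual_algebra sC \<Delta> \<epsilon>) (dual_module sM \<rho>)"
  proof (unfold_locales)
    fix f assume f: "f \<in> N"
    \<comment> \<open>The negative of the counit acts as negation, which yields closure under
      additive inverses.\<close>
    have "(\<lambda>c. (- 1) * \<epsilon> c) \<in> dual_space sC"
      using counit_dual by (simp add: dual_space_iff)
    with N f have "(\<lambda>m. f (m \<triangleleft> (\<lambda>c. (- 1) * \<epsilon> c))) \<in> N" by blast
    moreover have f_dual: "f \<in> dual_space sM" using N f by blast
    ultimately have minus: "(\<lambda>m. - f m) \<in> N"
      unfolding act_scale_right act_counit by (simp add: M.dual_space_scale del: M.scale_minus_left)
    have "inv\<^bsub>?G\<^esub> f = (\<lambda>m. - f m)"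
      unfolding m_inv_def
    proof (rule the_equality)
      show "(\<lambda>m. - f m) \<in> carrier ?G \<and> f \<otimes>\<^bsub>?G\<^esub> (\<lambda>m. - f m) = \<one>\<^bsub>?G\<^esub> \<and> (\<lambda>m. - f m) \<otimes>\<^bsub>?G\<^esub> f = \<one>\<^bsub>?G\<^esub>"
        using minus N by (auto simp: dual_module_def)
    next
      fix g assume "g \<in> carrier ?G \<and> f \<otimes>\<^bsub>?G\<^esub> g = \<one>\<^bsub>?G\<^esub> \<and> g \<otimes>\<^bsub>?G\<^esub> f = \<one>\<^bsub>?G\<^esub>"
      then show "g = (\<lambda>m. - f m)"
        by (auto simp: dual_module_def fun_eq_iff eq_neg_iff_add_eq_0)
    qed
    with minus show "inv\<^bsub>?G\<^esub> f \<in> N" by simp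
  qed (use N in \<open>auto simp: dual_module_def dual_algebra_def\<close>)
qed

lemma act_functional_dual:
  "f \<in> dual_space sM \<Longrightarrow> \<phi> \<in> dual_space sC \<Longrightarrow> (\<lambda>m. f (m \<triangleleft> \<phi>)) \<in> dual_space sM"
  by (simp add: M.dual_space_iff act_add_left act_scale_left)

lemma submodule_perp:
  assumes "subcomodule sM \<rho> X"
  shows "submodule (perp sM X) (dual_algebra sC \<Delta> \<epsilon>) (dual_module sM \<rho>)"
  unfolding submodule_iff
proof (intro conjI ballI)
  fix \<phi> f assume "\<phi> \<in> dual_space sC" "f \<in> perp sM X"
  then show "(\<lambda>m. f (m \<triangleleft> \<phi>)) \<in> perp sM X"
    using assms act_functional_dual by (simp add: perp_def subcomodule_iff)
qed (auto simp: perp_def M.dual_space_iff algebra_simps)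

text \<open>\<open>C\<^sup>* f\<close> is the image of the transpose of \<open>m \<mapsto> m\<^sub>-\<^sub>1 f(m\<^sub>0)\<close>, hence consists of all
  functionals that vanish on the kernel of this map.\<close>

lemma perp_cyclic:
  assumes f: "f \<in> dual_space sM" and g: "g \<in> perp sM {m. \<forall>\<phi>\<in>dual_space sC. f (m \<triangleleft> \<phi>) = 0}"
  obtains \<phi> where "\<phi> \<in> dual_space sC" "g = (\<lambda>m. f (m \<triangleleft> \<phi>))"
proof -
  define h where "h m = lin_ext sC (\<lambda>(x, n). sC (f n) x) (rep (\<rho> m))" for m
  have "tensor_bilinear sC sM sC (\<lambda>x n. sC (f n) x)"
    using f by (auto simp: tensor_bilinear_def Vector_Spaces.linear_iff M.dual_space_iff
        vector_space_axioms M.vector_space_axioms scale_left_distrib scale_right_distrib mult.commute)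
  then have h: "Vector_Spaces.linear sM sC h"
    unfolding h_def by (rule linear_to_quotient_lift[OF M.vector_space_axioms coact_linear])
  \<comment> \<open>The transpose of \<open>h\<close> sends \<open>\<phi>\<close> to the product of
    \<open>\<phi>\<close> with \<open>f\<close>: both sides contract the representative of
    \<open>\<rho> m\<close> to the sum of \<open>\<phi> x * f n\<close>.\<close>
  have f_act: "\<phi> (h m) = f (m \<triangleleft> \<phi>)" if \<phi>: "\<phi> \<in> dual_space sC" for \<phi> m
  proof -
    have "\<phi> (h m) = lin_ext (*) (\<lambda>(x, n). \<phi> x * f n) (rep (\<rho> m))"
      using \<phi> unfolding h_def
      by (subst linear_lin_ext[where ?s2.0 = "(*)"])
        (simp_all add: dual_space_def case_prod_unfold dual_space_scale[OF \<phi>] mult.commute)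
    also have "\<dots> = f (m \<triangleleft> \<phi>)"
      using f unfolding right_action_def
      by (subst linear_lin_ext[where ?s2.0 = "(*)"])
        (simp_all add: dual_space_def case_prod_unfold M.dual_space_scale[OF f])
    finally show ?thesis .
  qed
  have "g m = 0" if "h m = 0" for m
  proof -
    have "f (m \<triangleleft> \<phi>) = 0" if "\<phi> \<in> dual_space sC" for \<phi>
      using f_act[OF that, of m] \<open>h m = 0\<close> dual_space_0[OF that] by simp
    then show ?thesis using g by (simp add: perp_def)
  qed
  moreover have "g \<in> dual_space sM" using g by (simp add: perp_def)
  ultimately obtain \<phi> where "\<phi> \<in> dual_space sC" "\<And>m. \<phi> (h m) = g m"
    using functional_factor[OF h] by metis
  then show thesis using f_act by (intro that[of \<phi>]) auto
qed

text \<open>This set is the annihilator in \<open>M\<close> of the cyclic submodule of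
  \<open>f\<close>. It is stable because two successive actions amount to one by the convolution,
  again a linear functional.\<close>

lemma subcomodule_cyclic_annihilator:
  assumes f: "f \<in> dual_space sM"
  shows "subcomodule sM \<rho> {m. \<forall>\<phi>\<in>dual_space sC. f (m \<triangleleft> \<phi>) = 0}"
  unfolding subcomodule_iff
proof
  have "M.subspace {m. \<forall>g\<in>(\<lambda>\<phi> m. f (m \<triangleleft> \<phi>)) ` dual_space sC. g m = 0}"
    using act_functional_dual[OF f] by (intro M.subspace_annihilator) blast
  then show "M.subspace {m. \<forall>\<phi>\<in>dual_space sC. f (m \<triangleleft> \<phi>) = 0}" by simp
qed (simp add: act_act convolution_dual)

section \<open>Chain conditions\<close>

text \<open>The descending chain condition makes strict inclusion well founded on the family, which
  yields a minimal element.\<close>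

lemma artinian_minimal:
  assumes art: "artinian_comodule sM \<rho>" and "X\<^sub>0 \<in> \<X>" and sub: "\<And>X. X \<in> \<X> \<Longrightarrow> subcomodule sM \<rho> X"
  obtains X where "X \<in> \<X>" "\<And>Y. Y \<in> \<X> \<Longrightarrow> Y \<subseteq> X \<Longrightarrow> Y = X"
proof -
  let ?r = "{(Y, X). Y \<in> \<X> \<and> X \<in> \<X> \<and> Y \<subset> X}"
  have wf: "wf ?r"
    unfolding wf_iff_no_infinite_down_chain
  proof
    assume "\<exists>X. \<forall>i. (X (Suc i), X i) \<in> ?r"
    then obtain X where "\<forall>i. (X (Suc i), X i) \<in> ?r" ..
    then have X: "X i \<in> \<X> \<and> X (Suc i) \<subset> X i" for i by auto
    then have "(\<forall>n. subcomodule sM \<rho> (X n)) \<and> (\<forall>n. X (Suc n) \<subseteq> X n)"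
      using sub by (auto simp: psubset_eq)
    from mp[OF spec[OF art[unfolded artinian_comodule_def]] this]
    obtain n where "\<forall>k\<ge>n. X k = X n" ..
    from this[rule_format, of "Suc n"] have "X (Suc n) = X n" by simp
    with X[of n] show False by blast
  qed
  obtain X where "X \<in> \<X>" "\<And>Y. (Y, X) \<in> ?r \<Longrightarrow> Y \<notin> \<X>"
    by (rule wfE_min[OF wf assms(2)]) blast
  then show thesis by (intro that[of X]) blast+
qed

text \<open>Take \<open>X\<close> minimal among the subcomodules with \<open>X\<^sup>\<bottom> \<subseteq> N\<close>.  For \<open>f \<in> N\<close> and
  \<open>K = (C\<^sup>* f)\<^sup>\<bottom>\<close>, also \<open>(X \<inter> K)\<^sup>\<bottom> = X\<^sup>\<bottom> + C\<^sup>* f \<subseteq> N\<close>; so \<open>X \<subseteq> K\<close>, whence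
  \<open>f\<close> vanishes on \<open>X\<close>.\<close>

lemma artinian_submodule_perp:
  assumes art: "artinian_comodule sM \<rho>"
    and N: "submodule N (dual_algebra sC \<Delta> \<epsilon>) (dual_module sM \<rho>)"
  obtains X where "subcomodule sM \<rho> X" "N = perp sM X"
proof -
  note N' = N[unfolded submodule_iff]
  let ?\<X> = "{X. subcomodule sM \<rho> X \<and> perp sM X \<subseteq> N}"
  \<comment> \<open>The zero submodule lies in \<open>N\<close>, so the whole comodule belongs to
    the family, which is therefore nonempty.\<close>
  have "perp sM UNIV \<subseteq> {\<lambda>m. 0}" by (auto simp: perp_def)
  then have "UNIV \<in> ?\<X>" using subcomodule_UNIV N' by blast
  then obtain X where X: "X \<in> ?\<X>" "\<And>Y. Y \<in> ?\<X> \<Longrightarrow> Y \<subseteq> X \<Longrightarrow> Y = X"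
    by (rule artinian_minimal[OF art]) auto
  have "f \<in> perp sM X" if "f \<in> N" for f
  proof -
    have f: "f \<in> dual_space sM" using N' that by blast
    define K where "K = {m. \<forall>\<phi>\<in>dual_space sC. f (m \<triangleleft> \<phi>) = 0}"
    have K: "subcomodule sM \<rho> K"
      unfolding K_def by (rule subcomodule_cyclic_annihilator[OF f])
    have "perp sM (X \<inter> K) \<subseteq> N"
    proof
      fix g assume "g \<in> perp sM (X \<inter> K)"
      then obtain g1 g2 where g: "g1 \<in> perp sM X" "g2 \<in> perp sM K" "g = (\<lambda>m. g1 m + g2 m)"
        using M.perp_Int_decompose[of X K g] X(1) subcomodule_subspace[OF K] subcomodule_subspace
        by blast
      obtain \<phi> where "\<phi> \<in> dual_space sC" "g2 = (\<lambda>m. f (m \<triangleleft> \<phi>))"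
        using perp_cyclic[OF f g(2)[unfolded K_def]] .
      then have "g2 \<in> N" using N' that by blast
      then show "g \<in> N" using N' g X(1) by blast
    qed
    then have "X \<inter> K = X" using X subcomodule_Int[OF _ K] by blast
    \<comment> \<open>Membership in \<open>K\<close> is used at the counit, which acts as the
      identity.\<close>
    then have "f (x \<triangleleft> \<epsilon>) = 0" if "x \<in> X" for x
      using that counit_dual unfolding K_def by blast
    with f show ?thesis by (simp add: perp_def act_counit)
  qed
  with X(1) show thesis by (intro that[of X]) auto
qed

text \<open>To see \<open>f\<close> in the closure of \<open>N\<close>, consider the neighborhood
  given by \<open>Y\<close>. The chain \<open>X n \<inter> Y\<close> becomes stationary in finite
  dimension, so \<open>f\<close> vanishes on some \<open>X n \<inter> Y\<close> and splits into
  parts vanishing on \<open>X n\<close> and on \<open>Y\<close>; removing the latter leaves an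
  element of \<open>N\<close>.\<close>

lemma closed_imp_artinian:
  assumes closed: "\<And>N. submodule N (dual_algebra sC \<Delta> \<epsilon>) (dual_module sM \<rho>) \<Longrightarrow>
    closedin (finite_topology sM \<rho>) N"
  shows "artinian_comodule sM \<rho>"
  unfolding artinian_comodule_def
proof (intro allI impI, rule ccontr)
  fix X assume X: "(\<forall>n. subcomodule sM \<rho> (X n)) \<and> (\<forall>n. X (Suc n) \<subseteq> X n)"
    and unstable: "\<nexists>n. \<forall>k\<ge>n. X k = X n"
  have dec: "antimono X" using X by (simp add: decseq_SucI)
  have sub: "M.subspace (X n)" for n using X subcomodule_subspace by blast
  obtain f where f: "f \<in> perp sM (\<Inter>n. X n)" "\<And>n. f \<notin> perp sM (X n)"
    using M.functional_detecting_chain[OF sub dec unstable] by blast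
  define N where "N = (\<Union>n. perp sM (X n))"
  have perp_mono: "perp sM (X i) \<subseteq> perp sM (X j)" if "i \<le> j" for i j
    by (rule perp_antimono) (rule antimonoD[OF dec that])
  have "submodule N (dual_algebra sC \<Delta> \<epsilon>) (dual_module sM \<rho>)"
    unfolding submodule_iff
  proof (intro conjI ballI)
    fix g h assume "g \<in> N" "h \<in> N"
    then obtain i j where "g \<in> perp sM (X i)" "h \<in> perp sM (X j)" by (auto simp: N_def)
    then have "g \<in> perp sM (X (max i j))" "h \<in> perp sM (X (max i j))"
      using perp_mono[of i "max i j"] perp_mono[of j "max i j"] by auto
    then have "(\<lambda>m. g m + h m) \<in> perp sM (X (max i j))"
      using submodule_perp X unfolding submodule_iff by blast
    then show "(\<lambda>m. g m + h m) \<in> N" by (auto simp: N_def)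
  next
    fix \<phi> g assume "\<phi> \<in> dual_space sC" "g \<in> N"
    then show "(\<lambda>m. g (m \<triangleleft> \<phi>)) \<in> N"
      using submodule_perp X unfolding submodule_iff N_def by blast
  qed (auto simp: N_def perp_def M.dual_space_iff)
  then have "closedin (finite_topology sM \<rho>) N" by (rule closed)
  moreover have "f \<in> dual_space sM - N" using f by (auto simp: N_def perp_def)
  ultimately obtain Y where Y: "finite_dim_subcomodule sM \<rho> Y"
      and disj: "\<And>g. g \<in> perp sM Y \<Longrightarrow> (\<lambda>m. f m + g m) \<notin> N"
    unfolding closedin_finite_topology by blast
  obtain W where W: "finite W" "Y = M.span W" using Y by (auto simp: finite_dim_subcomodule_def)
  have Y_sub: "M.subspace Y" by (simp add: W)
  have "antimono (\<lambda>n. X n \<inter> Y)"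
    using antimonoD[OF dec] by (intro antimonoI) blast
  then obtain n where n: "\<And>k. n \<le> k \<Longrightarrow> X k \<inter> Y = X n \<inter> Y"
    using M.finite_dim_chain_stable[of W "\<lambda>n. X n \<inter> Y"] W sub Y_sub M.subspace_inter by blast
  \<comment> \<open>Compare at \<open>max n k\<close>: there the intersection with \<open>Y\<close>
    is already the stable one.\<close>
  have "X n \<inter> Y \<subseteq> X k" for k
    using n[of "max n k"] antimonoD[OF dec, of k "max n k"] by auto
  then have "X n \<inter> Y \<subseteq> (\<Inter>k. X k)" by blast
  then have "f \<in> perp sM (X n \<inter> Y)" using f(1) perp_antimono by blast
  then obtain g h where gh: "g \<in> perp sM (X n)" "h \<in> perp sM Y" "f = (\<lambda>m. g m + h m)"
    using M.perp_Int_decompose[OF sub Y_sub] by blast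
  \<comment> \<open>The functional \<open>g\<close>, which is \<open>f\<close> minus
    \<open>h\<close>, lies both in the neighborhood of \<open>f\<close> and in
    \<open>N\<close>.\<close>
  have "(\<lambda>m. - h m) \<in> perp sM Y" using gh(2) by (simp add: perp_def M.dual_space_iff)
  moreover have "(\<lambda>m. f m + - h m) = g" by (simp add: gh(3))
  moreover have "g \<in> N" using gh(1) by (auto simp: N_def)
  ultimately show False using disj by metis
qed

lemma noetherian_imp_artinian:
  assumes noeth: "noetherian_module (dual_algebra sC \<Delta> \<epsilon>) (dual_module sM \<rho>)"
  shows "artinian_comodule sM \<rho>"
  unfolding artinian_comodule_def
proof (intro allI impI)
  fix X assume X: "(\<forall>n. subcomodule sM \<rho> (X n)) \<and> (\<forall>n. X (Suc n) \<subseteq> X n)"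
  then have "\<forall>n. submodule (perp sM (X n)) (dual_algebra sC \<Delta> \<epsilon>) (dual_module sM \<rho>)"
    using submodule_perp by blast
  moreover have "\<forall>n. perp sM (X n) \<subseteq> perp sM (X (Suc n))"
    using X perp_antimono by blast
  ultimately obtain n where n: "\<forall>k\<ge>n. perp sM (X k) = perp sM (X n)"
    using spec[OF noeth[unfolded noetherian_module_def], of "\<lambda>n. perp sM (X n)"] by blast
  have X_eq: "X k = {m. \<forall>f\<in>perp sM (X k). f m = 0}" for k
    by (rule M.subspace_eq_annihilator_perp, rule subcomodule_subspace) (simp add: X)
  show "\<exists>n. \<forall>k\<ge>n. X k = X n"
  proof (intro exI allI impI)
    fix k assume "n \<le> k"
    then have "perp sM (X k) = perp sM (X n)" by (rule n[rule_format])
    then have "{m. \<forall>f\<in>perp sM (X k). f m = 0} = {m. \<forall>f\<in>perp sM (X n). f m = 0}"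
      by (simp only:)
    then show "X k = X n" by (simp only: X_eq[symmetric])
  qed
qed

lemma artinian_imp_noetherian:
  assumes art: "artinian_comodule sM \<rho>"
  shows "noetherian_module (dual_algebra sC \<Delta> \<epsilon>) (dual_module sM \<rho>)"
  unfolding noetherian_module_def
proof (intro allI impI)
  fix N assume N: "(\<forall>n. submodule (N n) (dual_algebra sC \<Delta> \<epsilon>) (dual_module sM \<rho>)) \<and>
    (\<forall>n. N n \<subseteq> N (Suc n))"
  then have "\<exists>X. subcomodule sM \<rho> X \<and> N n = perp sM X" for n
    using artinian_submodule_perp[OF art] by metis
  then obtain X where X: "\<And>n. subcomodule sM \<rho> (X n)" "\<And>n. N n = perp sM (X n)"
    by metis
  \<comment> \<open>Recovering \<open>X n\<close> as the annihilator of \<open>N n\<close> shows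
    that the chosen subcomodules decrease as the submodules increase.\<close>
  have X_eq: "X n = {m. \<forall>f\<in>N n. f m = 0}" for n
    unfolding X(2) by (rule M.subspace_eq_annihilator_perp[OF subcomodule_subspace[OF X(1)]])
  have "X (Suc n) \<subseteq> X n" for n
    using N unfolding X_eq[of n] X_eq[of "Suc n"] by blast
  with X(1) have "(\<forall>n. subcomodule sM \<rho> (X n)) \<and> (\<forall>n. X (Suc n) \<subseteq> X n)"
    by blast
  from mp[OF spec[OF art[unfolded artinian_comodule_def]] this]
  obtain n where n: "\<forall>k\<ge>n. X k = X n" ..
  show "\<exists>n. \<forall>k\<ge>n. N k = N n"
  proof (intro exI allI impI)
    fix k assume "n \<le> k"
    then have "X k = X n" by (rule n[rule_format])
    then show "N k = N n" by (simp only: X(2))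
  qed
qed

end

theorem proposition2p3:
  fixes sC :: "'k::field \<Rightarrow> 'c::ab_group_add \<Rightarrow> 'c"
    and \<Delta> :: "'c \<Rightarrow> ('c \<times> 'c \<Rightarrow>\<^sub>0 'k) set"
    and \<epsilon> :: "'c \<Rightarrow> 'k"
    and sM :: "'k \<Rightarrow> 'm::ab_group_add \<Rightarrow> 'm"
    and \<rho> :: "'m \<Rightarrow> ('c \<times> 'm \<Rightarrow>\<^sub>0 'k) set"
  assumes "left_comodule sC \<Delta> \<epsilon> sM \<rho>"
  shows "((\<forall>N. submodule N (dual_algebra sC \<Delta> \<epsilon>) (dual_module sM \<rho>) \<longrightarrow>
              closedin (finite_topology sM \<rho>) N) \<longleftrightarrow>
            noetherian_module (dual_algebra sC \<Delta> \<epsilon>) (dual_module sM \<rho>)) \<and>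
         (noetherian_module (dual_algebra sC \<Delta> \<epsilon>) (dual_module sM \<rho>) \<longleftrightarrow>
            artinian_comodule sM \<rho>)"
proof -
  interpret left_comodule sC \<Delta> \<epsilon> sM \<rho> by fact
  \<comment> \<open>From (iii) to (i): each submodule is an annihilator, hence closed. Both
    equivalences then pass through (iii).\<close>
  have "closedin (finite_topology sM \<rho>) N"
    if "artinian_comodule sM \<rho>" "submodule N (dual_algebra sC \<Delta> \<epsilon>) (dual_module sM \<rho>)" for N
    using artinian_submodule_perp[OF that] closedin_perp by metis
  then show ?thesis
    using closed_imp_artinian noetherian_imp_artinian artinian_imp_noetherian by blast
qed

end
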